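(* Let $T>0$, $H\in]\frac12,1[$ and let $n\ge1$ be a natural number. Let $b_H>0$ be the constant of the inequality $\|\varphi\|_{|\mathcal{H}^H|}\le b_H\|\varphi\|_{L^{1/H}([0,T])}$. (a) Let $h\in L^{1/H}(\Lambda^{(n)}_T)$. Then, for $0\le s<t\le T$, $$\big\|K^{*,(n)}_{H,s,t}h\big\|_{L^2([0,t]^n)}\le2^{n/2}b_H^n\,\big\|h\,\mathbf{1}_{]s,t[}\big\|_{L^{1/H}(\Lambda_t^{(n)})},$$ where $h\,\mathbf{1}_{]s,t[}$ denotes the function $(\theta_1,\dots,\theta_n)\mapsto h(\theta_1,\dots,\theta_n)\mathbf{1}_{]s,t[}(\theta_n)$. Thus $K^{*,(n)}_{H,s,t}:L^{1/H}(\Lambda_t^{(n)})\to L^2([0,t]^n)$ is a linear continuous operator. (b) If $h\in L^q(\Lambda^{(n)}_T)$ with $qH>1$, then for $0\le s<t\le T$, $$\big\|K^{*,(n)}_{H,s,t}h\big\|_{L^2([0,t]^n)}\le2^{n/2}b_H^n\,\|h\|_{L^q(\Lambda_t^{(n)})}\,|t-s|^{H-1/q}.$$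
   Context: $\Lambda^{(n)}_t=\{(\theta_1,\dots,\theta_n)\in\mathbb{R}_+^n:0\le\theta_1\le\dots\le\theta_n\le t\}$. For $0<\theta<t$, $$K_H(t,\theta)=c_H\Big\{(t-\theta)^{H-\frac12}+\big(\tfrac12-H\big)\int_\theta^t(u-\theta)^{H-\frac32}\big(1-(\tfrac{\theta}{u})^{\frac12-H}\big)du\Big\},$$ where $c_H>0$ is the constant for which $\int_0^tK_H(t,\theta)\,dW_\theta$ ($W$ a standard Brownian motion) is a fractional Brownian motion with Hurst parameter $H$; thus $\frac{\partial K_H}{\partial t}(t,\theta)=c_H(H-\frac12)(\frac\theta t)^{\frac12-H}(t-\theta)^{H-\frac32}$. Write $K_H(dr,\theta)=\frac{\partial K_H}{\partial r}(r,\theta)\,dr$. For measurable $\varphi$ on $[0,T]$, $$\|\varphi\|^2_{|\mathcal{H}^H|}=\int_0^T\Big(\int_\theta^T|\varphi(r)|K_H(dr,\theta)\Big)^2d\theta=H(2H-1)\int_0^T\int_0^T|\varphi(r)||\varphi(\xi)||r-\xi|^{2H-2}\,dr\,d\xi,$$ and $b_H$ is a constant such that $\|\varphi\|_{|\mathcal{H}^H|}\le b_H\|\varphi\|_{L^{1/H}([0,T])}$ for all $\varphi$ (it exists by Hölder's and the Hardy–Littlewood–Sobolev inequalities). Kernels: for $0\le s<t\le T$, $$(K^{*,(1)}_{H,s,t}h)(\theta_1)=\int_{\theta_1}^th(r_1)K_H(dr_1,\theta_1)\,\mathbf{1}_{]s,t[}(\theta_1)+\int_s^th(r_1)K_H(dr_1,\theta_1)\,\mathbf{1}_{]0,s[}(\theta_1)\mathbf{1}_{\{s\ne0\}},$$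 and for $n\ge2$, writing $K^{*,(m)}_{H,r}:=K^{*,(m)}_{H,0,r}$ and $\vee$ for maximum, $$\begin{aligned}(K^{*,(n)}_{H,s,t}h)(\theta_1,\dots,\theta_n)=&\int_{\vee_{i=1}^n\theta_i}^t\big(K^{*,(n-1)}_{H,r_n}h(\cdot,r_n)\big)(\theta_1,\dots,\theta_{n-1})K_H(dr_n,\theta_n)\,\mathbf{1}_{[0,t]^{n-1}}(\theta_1,\dots,\theta_{n-1})\mathbf{1}_{]s,t[}(\theta_n)\\&+\int_{\vee_{i=1}^{n-1}\theta_i\vee s}^t\big(K^{*,(n-1)}_{H,r_n}h(\cdot,r_n)\big)(\theta_1,\dots,\theta_{n-1})K_H(dr_n,\theta_n)\,\mathbf{1}_{[0,t]^{n-1}}(\theta_1,\dots,\theta_{n-1})\mathbf{1}_{]0,s[}(\theta_n)\mathbf{1}_{\{s\ne0\}}.\end{aligned}$$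
   Formalization: Part (b) as printed fails by scaling for n ≥ 2 and large T (h = 1, s = 0, t = T); the right-hand side of (b) is multiplied by max(1,t)^{(n-1)(H-1/q)}, which equals 1 when n = 1 or t ≤ 1. *)

theory Defs
  imports "HOL-Probability.Probability"
begin

section \<open>The spaces \<open>L\<^sup>p\<close>\<close>

text \<open>Functions are kept as representatives; all identities between classes are stated almost
  everywhere. Norms take values in the extended nonnegative reals, so that no integrability
  is silently assumed.\<close>

definition ennreal_pow :: "ennreal \<Rightarrow> real \<Rightarrow> ennreal" where
  "ennreal_pow x a = (if x = \<infinity> then \<infinity> else ennreal (enn2real x powr a))"

definition Lp_norm :: "real \<Rightarrow> 'a measure \<Rightarrow> ('a \<Rightarrow> real) \<Rightarrow> ennreal" where
  "Lp_norm p M f = ennreal_pow (\<integral>\<^sup>+x. ennreal (\<bar>f x\<bar> powr p) \<partial>M) (1 / p)"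

definition Lp :: "real \<Rightarrow> 'a measure \<Rightarrow> ('a \<Rightarrow> real) set" where
  "Lp p M = {f \<in> borel_measurable M. Lp_norm p M f < \<infinity>}"

text \<open>A map on representatives induces a linear continuous operator \<open>L\<^sup>p(M) \<rightarrow> L\<^sup>q(N)\<close>:
  it takes values in \<open>L\<^sup>q(N)\<close>, respects almost everywhere equality, is additive and homogeneous
  almost everywhere, and is continuous for the norms.\<close>

definition Lp_linear_continuous ::
    "real \<Rightarrow> 'a measure \<Rightarrow> real \<Rightarrow> 'b measure \<Rightarrow> (('a \<Rightarrow> real) \<Rightarrow> 'b \<Rightarrow> real) \<Rightarrow> bool" where
  "Lp_linear_continuous p M q N A \<longleftrightarrow>
     (\<forall>f \<in> Lp p M. A f \<in> Lp q N) \<and>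
     (\<forall>f \<in> Lp p M. \<forall>g \<in> Lp p M. (AE x in M. f x = g x) \<longrightarrow> (AE y in N. A f y = A g y)) \<and>
     (\<forall>f \<in> Lp p M. \<forall>g \<in> Lp p M. AE y in N. A (\<lambda>x. f x + g x) y = A f y + A g y) \<and>
     (\<forall>f \<in> Lp p M. \<forall>a. AE y in N. A (\<lambda>x. a * f x) y = a * A f y) \<and>
     (\<forall>f \<in> Lp p M. \<forall>\<epsilon>>0. \<exists>\<delta>>0. \<forall>g \<in> Lp p M.
        Lp_norm p M (\<lambda>x. g x - f x) < ennreal \<delta> \<longrightarrow>
        Lp_norm q N (\<lambda>y. A g y - A f y) < ennreal \<epsilon>)"

text \<open>A point of \<open>\<real>\<^sup>n\<close> is a function on the index set \<open>{1..n}\<close>, equal to \<open>undefined\<close>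
  elsewhere.\<close>

abbreviation lborel_on :: "nat \<Rightarrow> (nat \<Rightarrow> real) set \<Rightarrow> (nat \<Rightarrow> real) measure" where
  "lborel_on n A \<equiv> restrict_space (\<Pi>\<^sub>M i\<in>{1..n}. lborel) A"

definition cube :: "nat \<Rightarrow> real \<Rightarrow> (nat \<Rightarrow> real) set" where
  "cube n t = {1..n} \<rightarrow>\<^sub>E {0..t}"

definition ord_simplex :: "nat \<Rightarrow> real \<Rightarrow> (nat \<Rightarrow> real) set" where
  "ord_simplex n t = {\<theta> \<in> extensional {1..n}.
     0 \<le> \<theta> 1 \<and> (\<forall>i\<in>{1..<n}. \<theta> i \<le> \<theta> (Suc i)) \<and> \<theta> n \<le> t}"


section \<open>The kernel \<open>K\<^sub>H\<close> and its normalising constant\<close>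

definition KH :: "real \<Rightarrow> real \<Rightarrow> real \<Rightarrow> real \<Rightarrow> real" where
  "KH c H t \<theta> = c * ((t - \<theta>) powr (H - 1/2)
     + (1/2 - H) * (LBINT u:{\<theta><..<t}. (u - \<theta>) powr (H - 3/2) * (1 - (\<theta> / u) powr (1/2 - H))))"

text \<open>The density of \<open>K\<^sub>H(dr,\<theta>)\<close>.\<close>

definition dKH :: "real \<Rightarrow> real \<Rightarrow> real \<Rightarrow> real \<Rightarrow> real" where
  "dKH c H r \<theta> = deriv (\<lambda>x. KH c H x \<theta>) r"

definition brownian_motion :: "'w measure \<Rightarrow> (real \<Rightarrow> 'w \<Rightarrow> real) \<Rightarrow> bool" where
  "brownian_motion M W \<longleftrightarrow> prob_space M \<and>
     (\<forall>t\<ge>0. W t \<in> borel_measurable M) \<and>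
     (AE \<omega> in M. W 0 \<omega> = 0) \<and>
     (AE \<omega> in M. continuous_on {0..} (\<lambda>t. W t \<omega>)) \<and>
     (\<forall>s t. 0 \<le> s \<and> s < t \<longrightarrow>
        distributed M lborel (\<lambda>\<omega>. W t \<omega> - W s \<omega>) (normal_density 0 (sqrt (t - s)))) \<and>
     (\<forall>N \<tau>. 0 \<le> \<tau> 0 \<and> (\<forall>i<N. \<tau> i < \<tau> (Suc i)) \<longrightarrow>
        prob_space.indep_vars M (\<lambda>_. borel) (\<lambda>i \<omega>. W (\<tau> (Suc i)) \<omega> - W (\<tau> i) \<omega>) {..<N::nat})"

text \<open>\<open>X\<close> is a version of the Wiener integral \<open>\<integral> f dW\<close> over the half-line: the limit in
  \<open>L\<^sup>2(M)\<close> of the elementary integrals of step functions converging to \<open>f\<close> in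
  \<open>L\<^sup>2([0,\<infinity>[)\<close>.\<close>

definition wiener_integral ::
    "'w measure \<Rightarrow> (real \<Rightarrow> 'w \<Rightarrow> real) \<Rightarrow> (real \<Rightarrow> real) \<Rightarrow> ('w \<Rightarrow> real) \<Rightarrow> bool" where
  "wiener_integral M W f X \<longleftrightarrow>
     f \<in> borel_measurable borel \<and> X \<in> borel_measurable M \<and>
     (\<exists>(N :: nat \<Rightarrow> nat) (\<tau> :: nat \<Rightarrow> nat \<Rightarrow> real) (a :: nat \<Rightarrow> nat \<Rightarrow> real).
        (\<forall>k. 0 \<le> \<tau> k 0 \<and> (\<forall>i<N k. \<tau> k i \<le> \<tau> k (Suc i))) \<and>
        (\<lambda>k. \<integral>\<^sup>+\<theta>\<in>{0..}. ennreal ((f \<theta> -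
             (\<Sum>i<N k. a k i * indicator {\<tau> k i<..\<tau> k (Suc i)} \<theta>))\<^sup>2) \<partial>lborel) \<longlonglongrightarrow> 0 \<and>
        (\<lambda>k. \<integral>\<^sup>+\<omega>. ennreal ((X \<omega> -
             (\<Sum>i<N k. a k i * (W (\<tau> k (Suc i)) \<omega> - W (\<tau> k i) \<omega>)))\<^sup>2) \<partial>M) \<longlonglongrightarrow> 0)"

definition centred_gaussian :: "'w measure \<Rightarrow> ('w \<Rightarrow> real) \<Rightarrow> bool" where
  "centred_gaussian M Y \<longleftrightarrow> Y \<in> borel_measurable M \<and>
     ((AE \<omega> in M. Y \<omega> = 0) \<or> (\<exists>\<sigma>>0. distributed M lborel Y (normal_density 0 \<sigma>)))"

definition fractional_brownian_motion ::
    "'w measure \<Rightarrow> real \<Rightarrow> (real \<Rightarrow> 'w \<Rightarrow> real) \<Rightarrow> bool" where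
  "fractional_brownian_motion M H B \<longleftrightarrow> prob_space M \<and>
     (\<forall>I a. finite I \<and> I \<subseteq> {0..} \<longrightarrow> centred_gaussian M (\<lambda>\<omega>. \<Sum>t\<in>I. a t * B t \<omega>)) \<and>
     (\<forall>s\<ge>0. \<forall>t\<ge>0. (\<integral>\<omega>. B s \<omega> * B t \<omega> \<partial>M)
        = (s powr (2*H) + t powr (2*H) - \<bar>t - s\<bar> powr (2*H)) / 2)"

definition kernel_constant :: "'w measure \<Rightarrow> (real \<Rightarrow> 'w \<Rightarrow> real) \<Rightarrow> real \<Rightarrow> real \<Rightarrow> bool" where
  "kernel_constant M W H c \<longleftrightarrow> c > 0 \<and>
     (\<exists>B. (\<forall>t\<ge>0. wiener_integral M W (\<lambda>\<theta>. indicator {0<..<t} \<theta> * KH c H t \<theta>) (B t)) \<and>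
          fractional_brownian_motion M H B)"


section \<open>The norm of \<open>|\<H>\<^sup>H|\<close>\<close>

text \<open>The first of the two expressions for the norm. As \<open>K\<^sub>H(dr,\<theta>)\<close> is a nonnegative measure
  for \<open>c > 0\<close> and \<open>H > 1/2\<close>, the embedding of its density into \<open>ennreal\<close> truncates nothing.\<close>

definition abs_HH_norm :: "real \<Rightarrow> real \<Rightarrow> real \<Rightarrow> (real \<Rightarrow> real) \<Rightarrow> ennreal" where
  "abs_HH_norm c H T \<phi> = ennreal_pow
     (\<integral>\<^sup>+\<theta>\<in>{0<..<T}. (\<integral>\<^sup>+r\<in>{\<theta><..<T}. ennreal (\<bar>\<phi> r\<bar> * dKH c H r \<theta>) \<partial>lborel)\<^sup>2 \<partial>lborel) (1/2)"

definition embedding_constant :: "real \<Rightarrow> real \<Rightarrow> real \<Rightarrow> real \<Rightarrow> bool" where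
  "embedding_constant c H T b \<longleftrightarrow>
     (\<forall>\<phi> \<in> borel_measurable (restrict_space lborel {0..T}).
        abs_HH_norm c H T \<phi> \<le> ennreal b * Lp_norm (1/H) (restrict_space lborel {0..T}) \<phi>)"


section \<open>The iterated operators \<open>K\<^sup>*\<close>\<close>

text \<open>\<open>Kstar c H n s t h \<theta>\<close> is the value of \<open>K\<^sup>*\<close> of order \<open>n\<close> with parameters \<open>s\<close>, \<open>t\<close>,
  applied to \<open>h\<close>, at the point \<open>\<theta>\<close>. The update \<open>x(n := r)\<close> appends the coordinate \<open>r\<close> to a point
  \<open>x\<close> with coordinates in \<open>{1..n-1}\<close>; \<open>(\<lambda>_. undefined)(1 := r)\<close> is the point of \<open>\<real>\<^sup>1\<close> with
  coordinate \<open>r\<close>. Order \<open>0\<close> is a dummy.\<close>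

fun Kstar :: "real \<Rightarrow> real \<Rightarrow> nat \<Rightarrow> real \<Rightarrow> real \<Rightarrow> ((nat \<Rightarrow> real) \<Rightarrow> real) \<Rightarrow> (nat \<Rightarrow> real) \<Rightarrow> real"
where
  "Kstar c H 0 s t h \<theta> = 0"
| "Kstar c H (Suc 0) s t h \<theta> =
     (LBINT r:{\<theta> 1<..<t}. h ((\<lambda>_. undefined)(1 := r)) * dKH c H r (\<theta> 1))
        * indicator {s<..<t} (\<theta> 1)
   + (LBINT r:{s<..<t}. h ((\<lambda>_. undefined)(1 := r)) * dKH c H r (\<theta> 1))
        * indicator {0<..<s} (\<theta> 1) * of_bool (s \<noteq> 0)"
| "Kstar c H (Suc (Suc m)) s t h \<theta> = (let n = Suc (Suc m) in
     (LBINT r:{Max (\<theta> ` {1..n})<..<t}.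
          Kstar c H (Suc m) 0 r (\<lambda>x. h (x(n := r))) \<theta> * dKH c H r (\<theta> n))
        * of_bool (\<forall>i\<in>{1..n-1}. \<theta> i \<in> {0..t}) * indicator {s<..<t} (\<theta> n)
   + (LBINT r:{max (Max (\<theta> ` {1..n-1})) s<..<t}.
          Kstar c H (Suc m) 0 r (\<lambda>x. h (x(n := r))) \<theta> * dKH c H r (\<theta> n))
        * of_bool (\<forall>i\<in>{1..n-1}. \<theta> i \<in> {0..t}) * indicator {0<..<s} (\<theta> n) * of_bool (s \<noteq> 0))"

text \<open>The Lebesgue integral of a non-integrable function is \<open>0\<close> by convention. The following
  predicate says that the convention is not used for the value of \<open>Kstar\<close> at \<open>\<theta>\<close>: every integral
  that enters with a nonzero indicator converges absolutely, and its integrand is itself well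
  defined in this sense for almost every \<open>r\<close>.\<close>

fun Kstar_defined ::
    "real \<Rightarrow> real \<Rightarrow> nat \<Rightarrow> real \<Rightarrow> real \<Rightarrow> ((nat \<Rightarrow> real) \<Rightarrow> real) \<Rightarrow> (nat \<Rightarrow> real) \<Rightarrow> bool"
where
  "Kstar_defined c H 0 s t h \<theta> = True"
| "Kstar_defined c H (Suc 0) s t h \<theta> = (
     (\<theta> 1 \<in> {s<..<t} \<longrightarrow>
        set_integrable lborel {\<theta> 1<..<t}
          (\<lambda>r. h ((\<lambda>_. undefined)(1 := r)) * dKH c H r (\<theta> 1))) \<and>
     (\<theta> 1 \<in> {0<..<s} \<longrightarrow>
        set_integrable lborel {s<..<t}
          (\<lambda>r. h ((\<lambda>_. undefined)(1 := r)) * dKH c H r (\<theta> 1))))"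
| "Kstar_defined c H (Suc (Suc m)) s t h \<theta> = (let n = Suc (Suc m) in
     (\<forall>i\<in>{1..n-1}. \<theta> i \<in> {0..t}) \<longrightarrow>
     (\<theta> n \<in> {s<..<t} \<longrightarrow>
        set_integrable lborel {Max (\<theta> ` {1..n})<..<t}
          (\<lambda>r. Kstar c H (Suc m) 0 r (\<lambda>x. h (x(n := r))) \<theta> * dKH c H r (\<theta> n)) \<and>
        (AE r in lborel. r \<in> {Max (\<theta> ` {1..n})<..<t} \<longrightarrow>
           Kstar_defined c H (Suc m) 0 r (\<lambda>x. h (x(n := r))) \<theta>)) \<and>
     (\<theta> n \<in> {0<..<s} \<longrightarrow>
        set_integrable lborel {max (Max (\<theta> ` {1..n-1})) s<..<t}
          (\<lambda>r. Kstar c H (Suc m) 0 r (\<lambda>x. h (x(n := r))) \<theta> * dKH c H r (\<theta> n)) \<and>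
        (AE r in lborel. r \<in> {max (Max (\<theta> ` {1..n-1})) s<..<t} \<longrightarrow>
           Kstar_defined c H (Suc m) 0 r (\<lambda>x. h (x(n := r))) \<theta>)))"

end

theory Submission
  imports Defs
begin

text \<open>The density of \<open>K\<^sub>H(dr,\<theta>)\<close> is a nonnegative kernel \<open>k r \<theta>\<close> that vanishes unless \<open>0 < \<theta> < r\<close>. The two
  terms in the definition of \<open>K\<^sup>*\<close> live on disjoint sets of \<open>\<theta>\<close>, and all lower integration
  limits are implied by the support of \<open>k\<close>; so, off the hyperplane \<open>\<theta> n = s\<close>, the operator is the
  \<open>n\<close>-fold tensor power of \<open>\<phi> \<mapsto> \<integral> \<phi>(r) k r \<theta> dr\<close> applied to \<open>h\<close> cut off to the part of the simplex with
  \<open>s < r n < t\<close>. The one-dimensional operator is bounded from \<open>L\<close> of exponent \<open>1/H\<close> to \<open>L\<^sup>2\<close> by hypothesis, and since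
  \<open>1/H \<le> 2\<close>, Minkowski's integral inequality with exponent \<open>2H\<close> tensorises the bound with constant
  \<open>b ^ n\<close>. The same estimate for the iterated integral of \<open>\<bar>h\<bar>\<close> shows that it is finite almost
  everywhere, which gives absolute convergence and linearity. Part (b) follows by Jensen's inequality on
  the slab \<open>s < \<theta> n < t\<close> of the simplex, whose measure is at most \<open>t ^ (n - 1) * (t - s)\<close>.\<close>

section \<open>Powers of extended nonnegative reals, Jensen and Minkowski\<close>

lemma ennreal_pow_ennreal: "0 \<le> x \<Longrightarrow> ennreal_pow (ennreal x) a = ennreal (x powr a)"
  by (simp add: ennreal_pow_def)

lemma ennreal_pow_infinity [simp]: "ennreal_pow \<infinity> a = \<infinity>" "ennreal_pow top a = \<infinity>"
  by (simp_all add: ennreal_pow_def)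

lemma ennreal_pow_0 [simp]: "ennreal_pow 0 a = 0"
  by (simp add: ennreal_pow_def)

lemma ennreal_pow_eq_0_iff [simp]: "ennreal_pow x a = 0 \<longleftrightarrow> x = 0"
  by (cases x) (auto simp: ennreal_pow_def)

lemma ennreal_pow_eq_top_iff [simp]: "ennreal_pow x a = top \<longleftrightarrow> x = top"
  by (cases x) (auto simp: ennreal_pow_def)

lemma ennreal_pow_less_top_iff [simp]: "ennreal_pow x a < top \<longleftrightarrow> x < top"
  by (simp add: less_top [symmetric])

lemma ennreal_pow_one [simp]: "ennreal_pow x 1 = x"
  by (cases x) (auto simp: ennreal_pow_def)

lemma ennreal_pow_2: "ennreal_pow x 2 = x\<^sup>2"
  by (cases x) (auto simp: ennreal_pow_def ennreal_power ennreal_top_eq_mult_iff power2_eq_square ennreal_mult)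

lemma ennreal_pow_pow: "ennreal_pow (ennreal_pow x a) b = ennreal_pow x (a * b)"
  by (cases x) (auto simp: ennreal_pow_def powr_powr)

lemma ennreal_pow_mult: "0 < a \<Longrightarrow> ennreal_pow (x * y) a = ennreal_pow x a * ennreal_pow y a"
  by (cases x; cases y)
    (auto simp: ennreal_pow_ennreal ennreal_mult[symmetric] powr_mult ennreal_mult_top ennreal_top_mult
      simp del: ennreal_mult)

lemma ennreal_pow_add: "0 < a \<Longrightarrow> 0 < b \<Longrightarrow> ennreal_pow x (a + b) = ennreal_pow x a * ennreal_pow x b"
  by (cases x) (auto simp: ennreal_pow_ennreal powr_add ennreal_mult ennreal_mult_top)

lemma ennreal_pow_mono: "0 \<le> a \<Longrightarrow> x \<le> y \<Longrightarrow> ennreal_pow x a \<le> ennreal_pow y a"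
  by (cases x; cases y) (auto simp: ennreal_pow_ennreal powr_mono2 top_unique)

lemma measurable_ennreal_pow [measurable]:
  assumes [measurable]: "f \<in> borel_measurable M"
  shows "(\<lambda>x. ennreal_pow (f x) a) \<in> borel_measurable M"
  unfolding ennreal_pow_def infinity_ennreal_def by measurable

text \<open>The convex function x^p lies above its tangent at a. The tangent inequality is arranged
  without subtraction, so that it carries over to \<open>ennreal\<close>.\<close>

lemma powr_Young:
  fixes x a p :: real
  assumes "1 < p" "0 \<le> x" "0 \<le> a"
  shows "p * a powr (p - 1) * x \<le> x powr p + (p - 1) * a powr p"
proof -
  have "x * a powr (p - 1) \<le> x powr p / p + (a powr (p - 1)) powr (p / (p - 1)) / (p / (p - 1))"
    using assms by (intro Youngs_inequality) (auto simp: field_simps)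
  also have "(a powr (p - 1)) powr (p / (p - 1)) = a powr p"
    using assms by (simp add: powr_powr)
  finally show ?thesis
    using assms by (simp add: field_simps)
qed

lemma ennreal_pow_Young:
  assumes "1 < p" "0 < a"
  shows "ennreal (p * a powr (p - 1)) * x \<le> ennreal_pow x p + ennreal ((p - 1) * a powr p)"
proof (cases x)
  case (real r)
  then show ?thesis
    using powr_Young[of p r a] assms
    by (simp add: ennreal_pow_ennreal flip: ennreal_mult ennreal_plus)
qed simp

text \<open>The tangent inequality is integrated for every a and then used at the mean value of f.
  The measure is not normalised, which is why a power of the total mass appears.\<close>

lemma (in finite_measure) ennreal_pow_Jensen:
  assumes p: "1 < p" and [measurable]: "f \<in> borel_measurable M"
  shows "ennreal_pow (\<integral>\<^sup>+x. f x \<partial>M) p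
    \<le> ennreal_pow (emeasure M (space M)) (p - 1) * (\<integral>\<^sup>+x. ennreal_pow (f x) p \<partial>M)"
proof -
  define F S D where "F = (\<integral>\<^sup>+x. f x \<partial>M)" and "S = emeasure M (space M)"
    and "D = (\<integral>\<^sup>+x. ennreal_pow (f x) p \<partial>M)"
  have *: "ennreal (p * a powr (p - 1)) * F \<le> D + ennreal ((p - 1) * a powr p) * S" if "0 < a" for a
  proof -
    have "ennreal (p * a powr (p - 1)) * F = (\<integral>\<^sup>+x. ennreal (p * a powr (p - 1)) * f x \<partial>M)"
      by (simp add: F_def nn_integral_cmult)
    also have "\<dots> \<le> (\<integral>\<^sup>+x. ennreal_pow (f x) p + ennreal ((p - 1) * a powr p) \<partial>M)"
      using p that by (intro nn_integral_mono ennreal_pow_Young)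
    also have "\<dots> = D + ennreal ((p - 1) * a powr p) * S"
      by (simp add: nn_integral_add D_def S_def)
    finally show ?thesis .
  qed
  \<comment> \<open>On a space of mass 0 every integral vanishes; this excludes a division by 0 in
    the mean value below.\<close>
  have S0: "F = 0" if "S = 0"
  proof -
    have "AE x in M. f x = 0"
      by (rule AE_I[of _ _ "space M"]) (use that in \<open>auto simp: S_def\<close>)
    then show ?thesis
      by (simp add: F_def nn_integral_0_iff_AE)
  qed
  obtain s where s: "S = ennreal s" "0 \<le> s"
    using emeasure_finite[of "space M"] by (cases S) (auto simp: S_def)
  consider "F = 0" | "F = top" | f where "F = ennreal f" "0 < f"
    by (cases F) (auto simp: less_le)
  then have "ennreal_pow F p \<le> ennreal_pow S (p - 1) * D"
  proof cases
    case 2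
    \<comment> \<open>Since the mass is finite, the tangent inequality at a = 1 already forces
      \<open>D\<close> to be infinite.\<close>
    have "top \<le> D + ennreal (p - 1) * S"
      using *[of 1] p 2 by (simp add: ennreal_mult_top)
    then have "D = top"
      using s by (cases D) (auto simp: top_unique ennreal_mult_eq_top_iff ennreal_mult[symmetric] simp flip: ennreal_plus)
    moreover have "S \<noteq> 0"
      using 2 S0 by auto
    ultimately show ?thesis by (simp add: ennreal_mult_top)
  next
    case (3 y)
    have s0: "0 < s"
    proof (rule ccontr)
      assume "\<not> 0 < s"
      then have "S = 0" using s by (simp add: ennreal_neg)
      then have "F = 0" by (rule S0)
      then show False using 3 by simp
    qed
    show ?thesis
    proof (cases D)
      case (real d)
      \<comment> \<open>This is the mean of f. With y = a * s the tangent inequality collapses to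
        a^p * s <= d, and multiplication by s^(p - 1) turns the left side into y^p.\<close>
      define a where "a = y / s"
      have a: "0 < a" using 3 s0 by (simp add: a_def)
      have y: "y = a * s" using s0 by (simp add: a_def)
      have ap: "a powr p = a powr (p - 1) * a"
        using a by (simp add: powr_diff)
      have "p * a powr (p - 1) * y \<le> d + (p - 1) * a powr p * s"
        using *[OF a] real 3 s a p s0
        by (simp flip: ennreal_mult ennreal_plus)
      then have "a powr p * s \<le> d" unfolding y ap by (simp add: algebra_simps)
      then have "s powr (p - 1) * (a powr p * s) \<le> s powr (p - 1) * d"
        by (intro mult_left_mono) auto
      also have "s powr (p - 1) * (a powr p * s) = y powr p"
        using a s0 by (simp add: y powr_mult powr_diff)
      finally show ?thesis
        using real 3 s by (simp add: ennreal_pow_ennreal flip: ennreal_mult)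
    next
      case top
      then show ?thesis using s0 s by (simp add: ennreal_pow_ennreal ennreal_mult_top)
    qed
  qed simp
  then show ?thesis by (simp add: F_def S_def D_def)
qed

lemma (in pair_sigma_finite) Minkowski_integral:
  assumes p: "1 < p" and [measurable]: "case_prod g \<in> borel_measurable (M1 \<Otimes>\<^sub>M M2)"
  shows "(\<integral>\<^sup>+x. ennreal_pow (\<integral>\<^sup>+y. g x y \<partial>M2) p \<partial>M1)
    \<le> ennreal_pow (\<integral>\<^sup>+y. ennreal_pow (\<integral>\<^sup>+x. ennreal_pow (g x y) p \<partial>M1) (1 / p) \<partial>M2) p"
proof -
  \<comment> \<open>For almost every \<open>x\<close>, apply Jensen to \<open>y \<mapsto> g x y / w y\<close> in the measure with density \<open>w\<close>, the
    \<open>L\<^sup>p\<close> norm of \<open>g\<close> in its first argument.\<close>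
  define w where "w y = ennreal_pow (\<integral>\<^sup>+x. ennreal_pow (g x y) p \<partial>M1) (1 / p)" for y
  have [measurable]: "w \<in> borel_measurable M2"
    unfolding w_def by measurable
  define S where "S = (\<integral>\<^sup>+y. w y \<partial>M2)"
  show ?thesis
  proof (cases "S = top")
    case True
    then show ?thesis by (simp add: S_def w_def)
  next
    case False
    interpret D: finite_measure "density M2 w"
      by (rule finite_measureI) (use False in \<open>simp add: emeasure_density S_def cong: nn_integral_cong_simp\<close>)
    have SD: "emeasure (density M2 w) (space (density M2 w)) = S"
      by (simp add: emeasure_density S_def cong: nn_integral_cong_simp)
    have wp: "ennreal_pow (w y) p = (\<integral>\<^sup>+x. ennreal_pow (g x y) p \<partial>M1)" for y
      using p by (simp add: w_def ennreal_pow_pow)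
    have fin: "AE y in M2. w y \<noteq> top"
      using False nn_integral_PInf_AE[of w M2] by (simp add: S_def)
    \<comment> \<open>The factorisation is in doubt only where w y is 0 or infinite. Where w y is 0,
      g x y is 0 for almost every x; where it is infinite, y lies in a null set because
      \<open>S\<close> is finite.\<close>
    have "AE y in M2. AE x in M1. g x y = w y * (g x y / w y)"
    proof (use fin AE_space in eventually_elim)
      case (elim y)
      from elim have [measurable]: "(\<lambda>x. g x y) \<in> borel_measurable M1" by simp
      show ?case
      proof (cases "w y = 0")
        case True
        then have "(\<integral>\<^sup>+x. ennreal_pow (g x y) p \<partial>M1) = 0"
          using wp[of y] by simp
        then show ?thesis
          using True by (subst (asm) nn_integral_0_iff_AE) auto
      next
        case False
        then show ?thesis using elim
          by (simp add: ennreal_times_divide ennreal_mult_divide_eq mult.commute[of "w y"])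
      qed
    qed
    then have AE_eq: "AE x in M1. AE y in M2. g x y = w y * (g x y / w y)"
      by (subst AE_commute) auto
    have "(\<integral>\<^sup>+x. \<integral>\<^sup>+y. w y * ennreal_pow (g x y / w y) p \<partial>M2 \<partial>M1)
        = (\<integral>\<^sup>+y. \<integral>\<^sup>+x. w y * ennreal_pow (g x y / w y) p \<partial>M1 \<partial>M2)"
      by (rule Fubini'[symmetric]) measurable
    also have "\<dots> \<le> S"
      unfolding S_def
    proof (intro nn_integral_mono_AE, use fin AE_space in eventually_elim)
      case (elim y)
      show ?case
      proof (cases "w y = 0")
        case False
        from elim have [measurable]: "(\<lambda>x. g x y) \<in> borel_measurable M1" by simp
        \<comment> \<open>Divided by its own norm w y, the function g has norm 1 in x, so each such
          y contributes exactly w y. The p-th power of w y may be cancelled because it is neither 0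
          nor infinite.\<close>
        have "ennreal_pow (w y) p * (\<integral>\<^sup>+x. ennreal_pow (g x y / w y) p \<partial>M1)
          = (\<integral>\<^sup>+x. ennreal_pow (w y * (g x y / w y)) p \<partial>M1)"
          using p by (simp add: ennreal_pow_mult nn_integral_cmult)
        also have "\<dots> = ennreal_pow (w y) p"
          using False elim by (simp add: wp ennreal_times_divide ennreal_mult_divide_eq mult.commute[of "w y"])
        finally have "ennreal_pow (w y) p * (\<integral>\<^sup>+x. ennreal_pow (g x y / w y) p \<partial>M1) = ennreal_pow (w y) p * 1"
          by simp
        then have "(\<integral>\<^sup>+x. ennreal_pow (g x y / w y) p \<partial>M1) = 1"
          using elim False by (subst (asm) ennreal_mult_cancel_left) auto
        then show ?thesis by (simp add: nn_integral_cmult)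
      next
        case True
        then show ?thesis by simp
      qed
    qed
    finally have le_S: "(\<integral>\<^sup>+x. \<integral>\<^sup>+y. w y * ennreal_pow (g x y / w y) p \<partial>M2 \<partial>M1) \<le> S" .
    have "(\<integral>\<^sup>+x. ennreal_pow (\<integral>\<^sup>+y. g x y \<partial>M2) p \<partial>M1)
        \<le> (\<integral>\<^sup>+x. ennreal_pow S (p - 1) * (\<integral>\<^sup>+y. w y * ennreal_pow (g x y / w y) p \<partial>M2) \<partial>M1)"
    proof (intro nn_integral_mono_AE, use AE_eq AE_space in eventually_elim)
      case (elim x)
      then have [measurable]: "g x \<in> borel_measurable M2" by simp
      have "(\<integral>\<^sup>+y. g x y \<partial>M2) = (\<integral>\<^sup>+y. w y * (g x y / w y) \<partial>M2)"
        using elim by (intro nn_integral_cong_AE)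
      also have "\<dots> = (\<integral>\<^sup>+y. g x y / w y \<partial>density M2 w)"
        by (simp add: nn_integral_density)
      also have "ennreal_pow \<dots> p \<le> ennreal_pow S (p - 1) * (\<integral>\<^sup>+y. ennreal_pow (g x y / w y) p \<partial>density M2 w)"
        using D.ennreal_pow_Jensen[OF p, of "\<lambda>y. g x y / w y"] unfolding SD by simp
      finally show ?case by (simp add: nn_integral_density)
    qed
    also have "\<dots> = ennreal_pow S (p - 1) * (\<integral>\<^sup>+x. \<integral>\<^sup>+y. w y * ennreal_pow (g x y / w y) p \<partial>M2 \<partial>M1)"
      by (simp add: nn_integral_cmult)
    also have "\<dots> \<le> ennreal_pow S (p - 1) * S"
      by (intro mult_left_mono le_S) simp
    also have "\<dots> = ennreal_pow S p"
      using ennreal_pow_add[of "p - 1" 1 S] p by simp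
    finally show ?thesis
      by (simp add: S_def w_def)
  qed
qed

section \<open>The derivative of the kernel\<close>

text \<open>For negative a the integrand is singular at \<theta>, but the antiderivative has the
  positive exponent a + 1 and is continuous up to \<theta>; the improper fundamental theorem for
  nonnegative integrands applies.\<close>

lemma set_integrable_shifted_powr:
  fixes a b \<theta> :: real
  assumes "- 1 < a"
  shows "set_integrable lborel {\<theta><..<b} (\<lambda>u. (u - \<theta>) powr a)"
proof (cases "\<theta> < b")
  case True
  have "set_integrable lborel (einterval (ereal \<theta>) (ereal b)) (\<lambda>u. (u - \<theta>) powr a)"
  proof (rule interval_integral_FTC_nonneg(1))
    show "((\<lambda>u. (u - \<theta>) powr (a + 1) / (a + 1)) has_real_derivative (x - \<theta>) powr a) (at x)"
      if "ereal \<theta> < ereal x" for x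
    proof -
      have "((\<lambda>u. (u - \<theta>) powr (a + 1)) has_real_derivative (a + 1) * (x - \<theta>) powr a) (at x)"
        using that by (auto intro!: derivative_eq_intros)
      from DERIV_cdivide[OF this, of "a + 1"] show ?thesis
        using assms by simp
    qed
    show "isCont (\<lambda>u. (u - \<theta>) powr a) x" if "ereal \<theta> < ereal x" for x
      using that by (auto intro!: continuous_intros)
    have "((\<lambda>u. (u - \<theta>) powr (a + 1) / (a + 1)) \<longlongrightarrow> (x - \<theta>) powr (a + 1) / (a + 1)) (at x within {\<theta>..})"
      if "\<theta> \<le> x" for x
      using that assms by (intro tendsto_intros tendsto_powr2) (auto simp: eventually_at_filter)
    then have *: "((\<lambda>u. (u - \<theta>) powr (a + 1) / (a + 1)) \<longlongrightarrow> (x - \<theta>) powr (a + 1) / (a + 1)) (at x within S)"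
      if "\<theta> \<le> x" "S \<subseteq> {\<theta>..}" for x S
      using that by (meson tendsto_within_subset)
    show "(((\<lambda>u. (u - \<theta>) powr (a + 1) / (a + 1)) \<circ> real_of_ereal) \<longlongrightarrow> (\<theta> - \<theta>) powr (a + 1) / (a + 1)) (at_right (ereal \<theta>))"
      unfolding ereal_tendsto_simps by (rule *) auto
    have "((\<lambda>u. (u - \<theta>) powr (a + 1) / (a + 1)) \<longlongrightarrow> (b - \<theta>) powr (a + 1) / (a + 1)) (at_left b)"
      using True assms by (intro tendsto_intros) auto
    then show "(((\<lambda>u. (u - \<theta>) powr (a + 1) / (a + 1)) \<circ> real_of_ereal) \<longlongrightarrow> (b - \<theta>) powr (a + 1) / (a + 1)) (at_left (ereal b))"
      unfolding ereal_tendsto_simps .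
  qed (use True in auto)
  then show ?thesis by simp
qed (simp add: set_integrable_def)

text \<open>The first term of \<open>KH\<close> contributes c (H - 1/2) (r - \<theta>)^(H - 3/2),
  and the integral contributes -c (H - 1/2) times its integrand at r. The summands without the
  quotient \<theta>/r cancel.\<close>

lemma dKH_eq:
  assumes H: "1/2 < H" and \<theta>: "0 < \<theta>" "\<theta> < r"
  shows "dKH c H r \<theta> = c * (H - 1/2) * (\<theta> / r) powr (1/2 - H) * (r - \<theta>) powr (H - 3/2)"
proof -
  define f where "f u = (u - \<theta>) powr (H - 3/2) * (1 - (\<theta> / u) powr (1/2 - H))" for u
  \<comment> \<open>The integral starts at the singularity \<theta>. The point \<open>r0\<close>
    strictly between \<theta> and r splits off a piece that does not depend on the upper limit; on
    {r0..R} the integrand is continuous and can be differentiated at the interior point r.\<close>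
  define r0 R where "r0 = (\<theta> + r) / 2" and "R = r + 1"
  have r0: "\<theta> < r0" "r0 < r" "r < R" using \<theta> by (auto simp: r0_def R_def)
  have f_int: "set_integrable lborel {\<theta><..<R} f"
  proof (rule set_integrable_bound)
    show "set_integrable lborel {\<theta><..<R} (\<lambda>u. (u - \<theta>) powr (H - 3/2) * (1 + (R / \<theta>) powr (H - 1/2)))"
      using H by (intro set_integrable_mult_left set_integrable_shifted_powr) auto
    have "\<bar>f u\<bar> \<le> (u - \<theta>) powr (H - 3/2) * (1 + (R / \<theta>) powr (H - 1/2))" if "\<theta> < u" "u < R" for u
    proof -
      have "(\<theta> / u) powr (1/2 - H) = (u / \<theta>) powr (H - 1/2)"
        using that \<theta> by (simp add: powr_divide powr_diff mult.commute)
      also have "\<dots> \<le> (R / \<theta>) powr (H - 1/2)"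
        using that \<theta> H by (intro powr_mono2) (auto simp: field_simps)
      finally have "\<bar>1 - (\<theta> / u) powr (1/2 - H)\<bar> \<le> 1 + (R / \<theta>) powr (H - 1/2)"
        by (smt (verit) powr_ge_zero)
      then show ?thesis
        unfolding f_def abs_mult by (intro mult_mono) auto
    qed
    then show "AE u in lborel. u \<in> {\<theta><..<R} \<longrightarrow> norm (f u) \<le> norm ((u - \<theta>) powr (H - 3/2) * (1 + (R / \<theta>) powr (H - 1/2)))"
      by (intro AE_I2) fastforce
  qed (simp add: f_def set_borel_measurable_def)
  have split: "(LBINT u:{\<theta><..<x}. f u) = (LBINT u=\<theta>..r0. f u) + (LBINT u=r0..x. f u)"
    if "r0 < x" "x < R" for x
  proof -
    have "set_integrable lborel {\<theta><..<x} f"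
      by (rule set_integrable_subset[OF f_int]) (use that r0 in auto)
    then have "(LBINT u=\<theta>..r0. f u) + (LBINT u=r0..x. f u) = (LBINT u=\<theta>..x. f u)"
      using that r0 by (intro interval_integral_sum) (simp add: min_def max_def interval_lebesgue_integrable_def)
    then show ?thesis
      using that r0 by (simp add: interval_integral_Ioo)
  qed
  have "((\<lambda>x. LBINT u=r0..x. f u) has_vector_derivative f r) (at r within {r0..R})"
    using r0 \<theta> by (intro interval_integral_FTC2) (auto simp: f_def intro!: continuous_intros)
  moreover have "at r within {r0..R} = at r"
    using r0 by (intro at_within_interior) auto
  ultimately have d: "((\<lambda>x. LBINT u=r0..x. f u) has_real_derivative f r) (at r)"
    by (simp add: has_real_derivative_iff_has_vector_derivative)
  have "((\<lambda>x. c * ((x - \<theta>) powr (H - 1/2) + (1/2 - H) * ((LBINT u=\<theta>..r0. f u) + (LBINT u=r0..x. f u))))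
     has_real_derivative c * ((H - 1/2) * (r - \<theta>) powr (H - 3/2) + (1/2 - H) * f r)) (at r)"
    using \<theta> by (auto intro!: derivative_eq_intros d simp: field_simps)
  then have "((\<lambda>x. KH c H x \<theta>)
     has_real_derivative c * ((H - 1/2) * (r - \<theta>) powr (H - 3/2) + (1/2 - H) * f r)) (at r)"
  proof (rule has_field_derivative_transform_within_open[where S = "{r0<..<R}"])
    show "c * ((x - \<theta>) powr (H - 1/2) + (1/2 - H) * ((LBINT u=\<theta>..r0. f u) + (LBINT u=r0..x. f u))) = KH c H x \<theta>"
      if "x \<in> {r0<..<R}" for x
      using split[of x] that by (simp add: KH_def f_def)
  qed (use r0 in auto)
  then have "dKH c H r \<theta> = c * ((H - 1/2) * (r - \<theta>) powr (H - 3/2) + (1/2 - H) * f r)"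
    unfolding dKH_def by (rule DERIV_imp_deriv)
  then show ?thesis
    by (simp add: f_def algebra_simps)
qed

section \<open>Iterated integrals against a Volterra kernel\<close>

abbreviation lborel_pow :: "nat \<Rightarrow> (nat \<Rightarrow> real) measure" where
  "lborel_pow n \<equiv> \<Pi>\<^sub>M i\<in>{1..n}. lborel"

lemma measurable_restrict_lborel_pow:
  "(\<lambda>x. \<lambda>i\<in>{1..n}. x i) \<in> measurable (\<Pi>\<^sub>M i\<in>UNIV. lborel) (lborel_pow n)"
  by (rule measurable_restrict_subset) simp

text \<open>Points of the finite product are functions on all natural numbers with the value
  \<open>undefined\<close> off the index set, so the remaining coordinate maps are constant.\<close>

lemma measurable_lborel_pow_UNIV:
  "(\<lambda>x. x) \<in> measurable (lborel_pow n) (\<Pi>\<^sub>M i\<in>UNIV. lborel)"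
proof (rule measurable_PiM_single')
  show "(\<lambda>x. x i) \<in> measurable (lborel_pow n) lborel" for i
  proof (cases "i \<in> {1..n}")
    case False
    have "(\<lambda>x. x i) \<in> measurable (lborel_pow n) lborel \<longleftrightarrow> (\<lambda>x. undefined :: real) \<in> measurable (lborel_pow n) lborel"
      by (intro measurable_cong PiE_arb[OF _ False]) (simp add: space_PiM)
    then show ?thesis by simp
  qed measurable
qed (auto simp: space_PiM)

lemma measurable_insert_coord [measurable]:
  "(\<lambda>x. x(Suc m := r)) \<in> measurable (lborel_pow m) (lborel_pow (Suc m))"
proof -
  have "(\<lambda>x. x(Suc m := r)) \<in> measurable (lborel_pow m) (\<Pi>\<^sub>M i\<in>insert (Suc m) {1..m}. lborel)"
    by (rule measurable_fun_upd[where J = "{1..m}"]) auto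
  then show ?thesis by (simp add: atLeastAtMostSuc_conv)
qed

lemma measurable_insert_coord_pair:
  "(\<lambda>(r, x). x(Suc m := r)) \<in> measurable (lborel \<Otimes>\<^sub>M lborel_pow m) (lborel_pow (Suc m))"
proof -
  have "(\<lambda>(r, x). x(Suc m := r)) \<in> measurable (lborel \<Otimes>\<^sub>M lborel_pow m) (\<Pi>\<^sub>M i\<in>insert (Suc m) {1..m}. lborel)"
    unfolding split_beta by (rule measurable_fun_upd[where J = "{1..m}"]) auto
  then show ?thesis by (simp add: atLeastAtMostSuc_conv)
qed

lemma measurable_indicator_Ioo:
  fixes f g :: "'a \<Rightarrow> real"
  assumes [measurable]: "f \<in> borel_measurable M" "g \<in> borel_measurable M"
  shows "(\<lambda>x. indicator {s<..<f x} (g x) :: real) \<in> borel_measurable M"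
  unfolding indicator_def greaterThanLessThan_iff by measurable

lemma upd_undefined_in_ord_simplex:
  "0 \<le> r \<Longrightarrow> r \<le> t \<Longrightarrow> (\<lambda>_. undefined)(Suc 0 := r) \<in> ord_simplex (Suc 0) t"
  by (auto simp: ord_simplex_def extensional_def)

text \<open>The time limit of the inner operator is the appended coordinate r itself, so the bound x
  m <= r on the smaller simplex becomes the new ordering relation.\<close>

lemma upd_in_ord_simplex:
  "x \<in> ord_simplex m r \<Longrightarrow> r \<le> t \<Longrightarrow> 1 \<le> m \<Longrightarrow> x(Suc m := r) \<in> ord_simplex (Suc m) t"
  by (auto simp: ord_simplex_def extensional_def le_Suc_eq)

locale volterra_kernel =
  fixes k :: "real \<Rightarrow> real \<Rightarrow> real"
  assumes k_nonneg: "0 \<le> k r \<theta>"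
    and k_eq_0: "\<not> (0 < \<theta> \<and> \<theta> < r) \<Longrightarrow> k r \<theta> = 0"
    and measurable_k: "case_prod k \<in> borel_measurable (lborel \<Otimes>\<^sub>M lborel)"
begin

lemma measurable_k' [measurable (raw)]:
  assumes [measurable]: "f \<in> borel_measurable M" "g \<in> borel_measurable M"
  shows "(\<lambda>x. k (f x) (g x)) \<in> borel_measurable M"
proof -
  have "(\<lambda>x. (f x, g x)) \<in> measurable M (lborel \<Otimes>\<^sub>M lborel)" by measurable
  from measurable_compose[OF this measurable_k] show ?thesis by simp
qed

text \<open>The order of recursion is that of \<open>Kstar\<close>; order \<open>0\<close> evaluates at the unique point of
  \<open>\<real>\<^sup>0\<close>, the constant function \<open>undefined\<close>.\<close>

fun iter_int :: "nat \<Rightarrow> real \<Rightarrow> real \<Rightarrow> ((nat \<Rightarrow> real) \<Rightarrow> real) \<Rightarrow> (nat \<Rightarrow> real) \<Rightarrow> real" where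
  "iter_int 0 s t h \<theta> = h (\<lambda>_. undefined)"
| "iter_int (Suc m) s t h \<theta> =
     (\<integral>r. indicator {s<..<t} r * k r (\<theta> (Suc m)) * iter_int m 0 r (\<lambda>x. h (x(Suc m := r))) \<theta> \<partial>lborel)"

fun iter_nn :: "nat \<Rightarrow> real \<Rightarrow> real \<Rightarrow> ((nat \<Rightarrow> real) \<Rightarrow> ennreal) \<Rightarrow> (nat \<Rightarrow> real) \<Rightarrow> ennreal" where
  "iter_nn 0 s t f \<theta> = f (\<lambda>_. undefined)"
| "iter_nn (Suc m) s t f \<theta> =
     (\<integral>\<^sup>+r. ennreal (indicator {s<..<t} r * k r (\<theta> (Suc m))) * iter_nn m 0 r (\<lambda>x. f (x(Suc m := r))) \<theta> \<partial>lborel)"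

section \<open>Support, locality and domination of the iterated integrals\<close>

lemma iter_int_eq_0: "i \<in> {1..m} \<Longrightarrow> \<not> (0 < \<theta> i \<and> \<theta> i < t) \<Longrightarrow> iter_int m s t h \<theta> = 0"
proof (induction m arbitrary: s t h)
  case (Suc m)
  have "indicator {s<..<t} r * k r (\<theta> (Suc m)) * iter_int m 0 r (\<lambda>x. h (x(Suc m := r))) \<theta> = 0" for r
  proof (cases "i = Suc m")
    case True
    then show ?thesis using Suc.prems k_eq_0[of "\<theta> i" r] by (auto simp: indicator_def)
  next
    case False
    then show ?thesis using Suc.prems Suc.IH[of r] by (auto simp: indicator_def)
  qed
  then show ?case by (simp only: iter_int.simps Bochner_Integration.integral_zero)
qed simp

text \<open>The unfolded recursion evaluates h only at increasing positive points whose last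
  coordinate lies in ]s,t[. This permits cutting h off to a slab of the simplex before
  estimating.\<close>

lemma iter_int_cong_simplex:
  assumes "\<And>x. x \<in> ord_simplex m t \<Longrightarrow> s < x m \<Longrightarrow> x m < t \<Longrightarrow> h x = h' x" "0 \<le> s" "1 \<le> m"
  shows "iter_int m s t h \<theta> = iter_int m s t h' \<theta>"
  using assms(3,1,2)
proof (induction m arbitrary: s t h h' rule: nat_induct_at_least)
  case base
  have "indicator {s<..<t} r * k r (\<theta> (Suc 0)) * h ((\<lambda>_. undefined)(Suc 0 := r))
      = indicator {s<..<t} r * k r (\<theta> (Suc 0)) * h' ((\<lambda>_. undefined)(Suc 0 := r))" for r
  proof (cases "r \<in> {s<..<t}")
    case True
    then have "(\<lambda>_. undefined)(Suc 0 := r) \<in> ord_simplex 1 t"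
      using base.prems(2) upd_undefined_in_ord_simplex[of r t] by simp
    moreover have "s < ((\<lambda>_. undefined)(Suc 0 := r)) 1" "((\<lambda>_. undefined)(Suc 0 := r)) 1 < t"
      using True by simp_all
    ultimately have "h ((\<lambda>_. undefined)(Suc 0 := r)) = h' ((\<lambda>_. undefined)(Suc 0 := r))"
      by (rule base.prems)
    then show ?thesis by simp
  qed simp
  then show ?case by (simp only: One_nat_def iter_int.simps)
next
  case (Suc m)
  have "indicator {s<..<t} r * k r (\<theta> (Suc m)) * iter_int m 0 r (\<lambda>x. h (x(Suc m := r))) \<theta>
      = indicator {s<..<t} r * k r (\<theta> (Suc m)) * iter_int m 0 r (\<lambda>x. h' (x(Suc m := r))) \<theta>" for r
  proof (cases "r \<in> {s<..<t}")
    case True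
    have "iter_int m 0 r (\<lambda>x. h (x(Suc m := r))) \<theta> = iter_int m 0 r (\<lambda>x. h' (x(Suc m := r))) \<theta>"
      using True Suc.hyps by (intro Suc.IH Suc.prems upd_in_ord_simplex) auto
    then show ?thesis by simp
  qed simp
  then show ?case by (simp only: iter_int.simps)
qed

lemma upd_in_extensional: "x \<in> extensional {1..m} \<Longrightarrow> x(Suc m := r) \<in> extensional {1..Suc m}"
  by (auto simp: extensional_def)

text \<open>Order 0 evaluates h at the only element of \<open>extensional {}\<close>, and all other
  points of evaluation arise from it by updates inside the index set. The measurability proofs use
  this to exchange h for a function of sequences.\<close>

lemma iter_int_cong_ext:
  "(\<And>x. x \<in> extensional {1..m} \<Longrightarrow> h x = h' x) \<Longrightarrow> iter_int m s t h \<theta> = iter_int m s t h' \<theta>"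
proof (induction m arbitrary: s t h h')
  case (Suc m)
  have "iter_int m 0 r (\<lambda>x. h (x(Suc m := r))) \<theta> = iter_int m 0 r (\<lambda>x. h' (x(Suc m := r))) \<theta>" for r
    by (intro Suc.IH Suc.prems upd_in_extensional)
  then show ?case by (simp only: iter_int.simps)
qed (simp add: extensional_def)

lemma iter_nn_cong_ext:
  "(\<And>x. x \<in> extensional {1..m} \<Longrightarrow> h x = h' x) \<Longrightarrow> iter_nn m s t h \<theta> = iter_nn m s t h' \<theta>"
proof (induction m arbitrary: s t h h')
  case (Suc m)
  have "iter_nn m 0 r (\<lambda>x. h (x(Suc m := r))) \<theta> = iter_nn m 0 r (\<lambda>x. h' (x(Suc m := r))) \<theta>" for r
    by (intro Suc.IH Suc.prems upd_in_extensional)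
  then show ?case by (simp only: iter_nn.simps)
qed (simp add: extensional_def)

lemma iter_int_scale: "iter_int m s t (\<lambda>x. a * h x) \<theta> = a * iter_int m s t h \<theta>"
proof (induction m arbitrary: s t h)
  case (Suc m)
  show ?case
    unfolding iter_int.simps Suc.IH mult.left_commute[of _ a] by simp
qed simp

lemma iter_nn_cong_upd: "i \<notin> {1..m} \<Longrightarrow> iter_nn m s t f (\<theta>(i := y)) = iter_nn m s t f \<theta>"
proof (induction m arbitrary: s t f)
  case (Suc m)
  then have "Suc m \<noteq> i" "i \<notin> {1..m}" by auto
  then show ?case
    by (simp only: iter_nn.simps Suc.IH fun_upd_other not_False_eq_True)
qed simp

text \<open>The triangle inequality is applied at each level. Nothing has to converge for this: a
  divergent Bochner integral is 0 by convention.\<close>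

lemma abs_iter_int_le: "ennreal \<bar>iter_int m s t h \<theta>\<bar> \<le> iter_nn m s t (\<lambda>x. ennreal \<bar>h x\<bar>) \<theta>"
proof (induction m arbitrary: s t h)
  case (Suc m)
  let ?F = "\<lambda>r. indicator {s<..<t} r * k r (\<theta> (Suc m)) * iter_int m 0 r (\<lambda>x. h (x(Suc m := r))) \<theta>"
  have "ennreal \<bar>integral\<^sup>L lborel ?F\<bar> \<le> (\<integral>\<^sup>+r. ennreal (norm (?F r)) \<partial>lborel)"
  proof (cases "integrable lborel ?F")
    case True
    from integral_norm_bound_ennreal[OF this] show ?thesis by simp
  qed (simp add: not_integrable_integral_eq)
  also have "\<dots> = (\<integral>\<^sup>+r. ennreal (indicator {s<..<t} r * k r (\<theta> (Suc m))) * ennreal \<bar>iter_int m 0 r (\<lambda>x. h (x(Suc m := r))) \<theta>\<bar> \<partial>lborel)"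
    by (intro nn_integral_cong) (simp add: abs_mult k_nonneg ennreal_mult)
  also have "\<dots> \<le> iter_nn (Suc m) s t (\<lambda>x. ennreal \<bar>h x\<bar>) \<theta>"
    unfolding iter_nn.simps by (intro nn_integral_mono mult_left_mono Suc.IH) auto
  finally show ?case by simp
qed simp

text \<open>In the recursion the function \<open>h\<close> itself depends on the outer variables. To have an induction
  hypothesis over a fixed measurable space, \<open>h\<close> is kept as a section of one function \<open>g\<close> on
  \<open>\<real>\<^sup>\<nat>\<close>, and the outer variables are collected in \<open>\<rho>\<close>.\<close>

lemma measurable_iter_nn_param:
  assumes g: "g \<in> borel_measurable (\<Pi>\<^sub>M i\<in>UNIV. lborel)"
  shows "(\<lambda>p. iter_nn m s (fst (snd p)) (\<lambda>x. g (\<lambda>i. if i \<in> {1..m} then x i else fst p i)) (snd (snd p)))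
    \<in> borel_measurable ((\<Pi>\<^sub>M i\<in>UNIV. lborel) \<Otimes>\<^sub>M lborel \<Otimes>\<^sub>M (\<Pi>\<^sub>M i\<in>UNIV. lborel))"
proof (induction m arbitrary: s)
  case 0
  then show ?case using measurable_compose[OF measurable_fst g] by simp
next
  case (Suc m)
  \<comment> \<open>The coordinate r bound by the outermost integral is an outer variable for the
    inner one. Moving it from the point into \<rho> brings the inner integral into the form of the
    induction hypothesis.\<close>
  have eq: "g (\<lambda>i. if i \<in> {1..Suc m} then (x(Suc m := r)) i else \<rho> i)
      = g (\<lambda>i. if i \<in> {1..m} then x i else (\<rho>(Suc m := r)) i)" for x r \<rho>
    by (rule arg_cong[of _ _ g]) auto
  let ?U = "\<Pi>\<^sub>M i\<in>(UNIV :: nat set). (lborel :: real measure)"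
  let ?V = "?U \<Otimes>\<^sub>M lborel \<Otimes>\<^sub>M ?U"
  have "(\<lambda>q. (fst (fst q))(Suc m := snd q)) \<in> measurable (?V \<Otimes>\<^sub>M lborel) ?U"
    by (rule measurable_fun_upd[where J = UNIV]) auto
  then have "(\<lambda>q. ((fst (fst q))(Suc m := snd q), snd q, snd (snd (fst q)))) \<in> measurable (?V \<Otimes>\<^sub>M lborel) ?V"
    by (intro measurable_Pair) simp_all
  from measurable_compose[OF this Suc.IH[of 0]]
  have *: "(\<lambda>q. iter_nn m 0 (snd q) (\<lambda>x. g (\<lambda>i. if i \<in> {1..m} then x i else ((fst (fst q))(Suc m := snd q)) i)) (snd (snd (fst q))))
      \<in> borel_measurable (?V \<Otimes>\<^sub>M lborel)"
    unfolding fst_conv snd_conv .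
  have "(\<lambda>q. snd (snd (fst q)) (Suc m)) \<in> borel_measurable (?V \<Otimes>\<^sub>M lborel)"
    by (rule measurable_compose[of _ _ ?U]) simp_all
  then have "(\<lambda>q. ennreal (indicator {s<..<fst (snd (fst q))} (snd q) * k (snd q) (snd (snd (fst q)) (Suc m)))) \<in> borel_measurable (?V \<Otimes>\<^sub>M lborel)"
    by (intro measurable_compose[OF _ measurable_ennreal] borel_measurable_times measurable_indicator_Ioo measurable_k') simp_all
  from borel_measurable_times_ennreal[OF this *] show ?case
    unfolding iter_nn.simps eq
    by (intro lborel.borel_measurable_nn_integral) (simp add: split_beta)
qed

lemma measurable_iter_int_param:
  assumes g: "g \<in> borel_measurable (\<Pi>\<^sub>M i\<in>UNIV. lborel)"
  shows "(\<lambda>p. iter_int m s (fst (snd p)) (\<lambda>x. g (\<lambda>i. if i \<in> {1..m} then x i else fst p i)) (snd (snd p)))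
    \<in> borel_measurable ((\<Pi>\<^sub>M i\<in>UNIV. lborel) \<Otimes>\<^sub>M lborel \<Otimes>\<^sub>M (\<Pi>\<^sub>M i\<in>UNIV. lborel))"
proof (induction m arbitrary: s)
  case 0
  then show ?case using measurable_compose[OF measurable_fst g] by simp
next
  case (Suc m)
  have eq: "g (\<lambda>i. if i \<in> {1..Suc m} then (x(Suc m := r)) i else \<rho> i)
      = g (\<lambda>i. if i \<in> {1..m} then x i else (\<rho>(Suc m := r)) i)" for x r \<rho>
    by (rule arg_cong[of _ _ g]) auto
  let ?U = "\<Pi>\<^sub>M i\<in>(UNIV :: nat set). (lborel :: real measure)"
  let ?V = "?U \<Otimes>\<^sub>M lborel \<Otimes>\<^sub>M ?U"
  have "(\<lambda>q. (fst (fst q))(Suc m := snd q)) \<in> measurable (?V \<Otimes>\<^sub>M lborel) ?U"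
    by (rule measurable_fun_upd[where J = UNIV]) auto
  then have "(\<lambda>q. ((fst (fst q))(Suc m := snd q), snd q, snd (snd (fst q)))) \<in> measurable (?V \<Otimes>\<^sub>M lborel) ?V"
    by (intro measurable_Pair) simp_all
  from measurable_compose[OF this Suc.IH[of 0]]
  have *: "(\<lambda>q. iter_int m 0 (snd q) (\<lambda>x. g (\<lambda>i. if i \<in> {1..m} then x i else ((fst (fst q))(Suc m := snd q)) i)) (snd (snd (fst q))))
      \<in> borel_measurable (?V \<Otimes>\<^sub>M lborel)"
    unfolding fst_conv snd_conv .
  have "(\<lambda>q. snd (snd (fst q)) (Suc m)) \<in> borel_measurable (?V \<Otimes>\<^sub>M lborel)"
    by (rule measurable_compose[of _ _ ?U]) simp_all
  then have "(\<lambda>q. indicator {s<..<fst (snd (fst q))} (snd q) * k (snd q) (snd (snd (fst q)) (Suc m))) \<in> borel_measurable (?V \<Otimes>\<^sub>M lborel)"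
    by (intro borel_measurable_times measurable_indicator_Ioo measurable_k') simp_all
  from borel_measurable_times[OF this *] show ?case
    unfolding iter_int.simps eq
    by (intro lborel.borel_measurable_lebesgue_integral) (simp add: split_beta)
qed

lemma measurable_iter_nn_step:
  assumes h: "h \<in> borel_measurable (lborel_pow (Suc m))"
  shows "(\<lambda>q. iter_nn m s (fst q) (\<lambda>x. h (x(Suc m := fst q))) (snd q))
    \<in> borel_measurable (lborel \<Otimes>\<^sub>M lborel_pow n)"
proof -
  define g where "g x = h (\<lambda>i\<in>{1..Suc m}. x i)" for x
  have g: "g \<in> borel_measurable (\<Pi>\<^sub>M i\<in>UNIV. lborel)"
    unfolding g_def by (rule measurable_compose[OF measurable_restrict_lborel_pow h])
  \<comment> \<open>Every outer variable is set to the time r. Of these, \<open>g\<close> reads only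
    the one with index \<open>Suc m\<close>, which is the appended coordinate.\<close>
  have "(\<lambda>q. (\<lambda>_. fst q, fst q, snd q)) \<in> measurable (lborel \<Otimes>\<^sub>M lborel_pow n)
      ((\<Pi>\<^sub>M i\<in>UNIV. lborel) \<Otimes>\<^sub>M lborel \<Otimes>\<^sub>M (\<Pi>\<^sub>M i\<in>UNIV. lborel))"
    by (intro measurable_Pair measurable_PiM_single' measurable_compose[OF measurable_snd measurable_lborel_pow_UNIV])
      auto
  from measurable_compose[OF this measurable_iter_nn_param[OF g, of m s]]
  have "(\<lambda>q. iter_nn m s (fst q) (\<lambda>x. g (\<lambda>i. if i \<in> {1..m} then x i else fst q)) (snd q))
      \<in> borel_measurable (lborel \<Otimes>\<^sub>M lborel_pow n)"
    unfolding fst_conv snd_conv .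
  moreover have "iter_nn m s r (\<lambda>x. h (x(Suc m := r))) \<theta>
      = iter_nn m s r (\<lambda>x. g (\<lambda>i. if i \<in> {1..m} then x i else r)) \<theta>" for r \<theta>
    unfolding g_def
    by (intro iter_nn_cong_ext arg_cong[of _ _ h]) (auto simp: fun_eq_iff extensional_def restrict_def)
  ultimately show ?thesis by simp
qed

lemma measurable_iter_nn:
  assumes h: "h \<in> borel_measurable (lborel_pow m)"
  shows "iter_nn m s t h \<in> borel_measurable (lborel_pow n)"
proof -
  define g where "g x = h (\<lambda>i\<in>{1..m}. x i)" for x
  have g: "g \<in> borel_measurable (\<Pi>\<^sub>M i\<in>UNIV. lborel)"
    unfolding g_def by (rule measurable_compose[OF measurable_restrict_lborel_pow h])
  have "(\<lambda>\<theta>. (\<lambda>_. 0, t, \<theta>)) \<in> measurable (lborel_pow n)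
      ((\<Pi>\<^sub>M i\<in>UNIV. lborel) \<Otimes>\<^sub>M lborel \<Otimes>\<^sub>M (\<Pi>\<^sub>M i\<in>UNIV. lborel))"
    by (intro measurable_Pair measurable_lborel_pow_UNIV) (auto simp: space_PiM)
  from measurable_compose[OF this measurable_iter_nn_param[OF g, of m s]]
  have "(\<lambda>\<theta>. iter_nn m s t (\<lambda>x. g (\<lambda>i. if i \<in> {1..m} then x i else 0)) \<theta>)
      \<in> borel_measurable (lborel_pow n)"
    unfolding fst_conv snd_conv .
  moreover have "iter_nn m s t h \<theta> = iter_nn m s t (\<lambda>x. g (\<lambda>i. if i \<in> {1..m} then x i else 0)) \<theta>" for \<theta>
    unfolding g_def
    by (intro iter_nn_cong_ext arg_cong[of _ _ h]) (auto simp: fun_eq_iff extensional_def restrict_def)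
  ultimately show ?thesis by (simp cong: measurable_cong)
qed

lemma measurable_iter_int_step:
  assumes h: "h \<in> borel_measurable (lborel_pow (Suc m))"
  shows "(\<lambda>q. iter_int m s (fst q) (\<lambda>x. h (x(Suc m := fst q))) (snd q))
    \<in> borel_measurable (lborel \<Otimes>\<^sub>M lborel_pow n)"
proof -
  define g where "g x = h (\<lambda>i\<in>{1..Suc m}. x i)" for x
  have g: "g \<in> borel_measurable (\<Pi>\<^sub>M i\<in>UNIV. lborel)"
    unfolding g_def by (rule measurable_compose[OF measurable_restrict_lborel_pow h])
  have "(\<lambda>q. (\<lambda>_. fst q, fst q, snd q)) \<in> measurable (lborel \<Otimes>\<^sub>M lborel_pow n)
      ((\<Pi>\<^sub>M i\<in>UNIV. lborel) \<Otimes>\<^sub>M lborel \<Otimes>\<^sub>M (\<Pi>\<^sub>M i\<in>UNIV. lborel))"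
    by (intro measurable_Pair measurable_PiM_single' measurable_compose[OF measurable_snd measurable_lborel_pow_UNIV])
      auto
  from measurable_compose[OF this measurable_iter_int_param[OF g, of m s]]
  have "(\<lambda>q. iter_int m s (fst q) (\<lambda>x. g (\<lambda>i. if i \<in> {1..m} then x i else fst q)) (snd q))
      \<in> borel_measurable (lborel \<Otimes>\<^sub>M lborel_pow n)"
    unfolding fst_conv snd_conv .
  moreover have "iter_int m s r (\<lambda>x. h (x(Suc m := r))) \<theta>
      = iter_int m s r (\<lambda>x. g (\<lambda>i. if i \<in> {1..m} then x i else r)) \<theta>" for r \<theta>
    unfolding g_def
    by (intro iter_int_cong_ext arg_cong[of _ _ h]) (auto simp: fun_eq_iff extensional_def restrict_def)
  ultimately show ?thesis by simp
qed

lemma measurable_iter_int: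
  assumes h: "h \<in> borel_measurable (lborel_pow m)"
  shows "iter_int m s t h \<in> borel_measurable (lborel_pow n)"
proof -
  define g where "g x = h (\<lambda>i\<in>{1..m}. x i)" for x
  have g: "g \<in> borel_measurable (\<Pi>\<^sub>M i\<in>UNIV. lborel)"
    unfolding g_def by (rule measurable_compose[OF measurable_restrict_lborel_pow h])
  have "(\<lambda>\<theta>. (\<lambda>_. 0, t, \<theta>)) \<in> measurable (lborel_pow n)
      ((\<Pi>\<^sub>M i\<in>UNIV. lborel) \<Otimes>\<^sub>M lborel \<Otimes>\<^sub>M (\<Pi>\<^sub>M i\<in>UNIV. lborel))"
    by (intro measurable_Pair measurable_lborel_pow_UNIV) (auto simp: space_PiM)
  from measurable_compose[OF this measurable_iter_int_param[OF g, of m s]]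
  have "(\<lambda>\<theta>. iter_int m s t (\<lambda>x. g (\<lambda>i. if i \<in> {1..m} then x i else 0)) \<theta>)
      \<in> borel_measurable (lborel_pow n)"
    unfolding fst_conv snd_conv .
  moreover have "iter_int m s t h \<theta> = iter_int m s t (\<lambda>x. g (\<lambda>i. if i \<in> {1..m} then x i else 0)) \<theta>" for \<theta>
    unfolding g_def
    by (intro iter_int_cong_ext arg_cong[of _ _ h]) (auto simp: fun_eq_iff extensional_def restrict_def)
  ultimately show ?thesis by (simp cong: measurable_cong)
qed

lemma measurable_iter_int_slice:
  assumes h: "h \<in> borel_measurable (lborel_pow (Suc m))" and \<theta>: "\<theta> \<in> extensional {1..n}"
  shows "(\<lambda>r. iter_int m s r (\<lambda>x. h (x(Suc m := r))) \<theta>) \<in> borel_measurable lborel"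
proof -
  have "(\<lambda>r. (r, \<theta>)) \<in> measurable lborel (lborel \<Otimes>\<^sub>M lborel_pow n)"
    using \<theta> by (intro measurable_Pair measurable_const) (auto simp: space_PiM PiE_def)
  from measurable_compose[OF this measurable_iter_int_step[OF h, of s]] show ?thesis by simp
qed

lemma measurable_iter_nn_slice:
  assumes h: "h \<in> borel_measurable (lborel_pow (Suc m))" and \<theta>: "\<theta> \<in> extensional {1..n}"
  shows "(\<lambda>r. iter_nn m s r (\<lambda>x. h (x(Suc m := r))) \<theta>) \<in> borel_measurable lborel"
proof -
  have "(\<lambda>r. (r, \<theta>)) \<in> measurable lborel (lborel \<Otimes>\<^sub>M lborel_pow n)"
    using \<theta> by (intro measurable_Pair measurable_const) (auto simp: space_PiM PiE_def)
  from measurable_compose[OF this measurable_iter_nn_step[OF h, of s]] show ?thesis by simp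
qed

section \<open>Absolute convergence and additivity\<close>

lemma integrable_iter_int:
  assumes h: "h \<in> borel_measurable (lborel_pow (Suc m))" and \<theta>: "\<theta> \<in> extensional {1..n}"
    and fin: "iter_nn (Suc m) s t (\<lambda>x. ennreal \<bar>h x\<bar>) \<theta> < \<infinity>"
  shows "integrable lborel (\<lambda>r. indicator {s<..<t} r * k r (\<theta> (Suc m)) * iter_int m 0 r (\<lambda>x. h (x(Suc m := r))) \<theta>)"
proof (rule integrableI_bounded)
  note [measurable] = measurable_iter_int_slice[OF h \<theta>]
  show "(\<lambda>r. indicator {s<..<t} r * k r (\<theta> (Suc m)) * iter_int m 0 r (\<lambda>x. h (x(Suc m := r))) \<theta>) \<in> borel_measurable lborel"
    by measurable
  have "(\<integral>\<^sup>+r. ennreal (norm (indicator {s<..<t} r * k r (\<theta> (Suc m)) * iter_int m 0 r (\<lambda>x. h (x(Suc m := r))) \<theta>)) \<partial>lborel)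
    = (\<integral>\<^sup>+r. ennreal (indicator {s<..<t} r * k r (\<theta> (Suc m))) * ennreal \<bar>iter_int m 0 r (\<lambda>x. h (x(Suc m := r))) \<theta>\<bar> \<partial>lborel)"
    by (intro nn_integral_cong) (simp add: abs_mult k_nonneg ennreal_mult)
  also have "\<dots> \<le> iter_nn (Suc m) s t (\<lambda>x. ennreal \<bar>h x\<bar>) \<theta>"
    unfolding iter_nn.simps by (intro nn_integral_mono mult_left_mono abs_iter_int_le) auto
  finally show "(\<integral>\<^sup>+r. ennreal (norm (indicator {s<..<t} r * k r (\<theta> (Suc m)) * iter_int m 0 r (\<lambda>x. h (x(Suc m := r))) \<theta>)) \<partial>lborel) < \<infinity>"
    using fin by (rule le_less_trans)
qed

text \<open>A finite integral has an almost everywhere finite integrand. A nonzero weight passes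
  this on to the inner factor; at weight 0 the product is 0 even if the inner factor is
  infinite.\<close>

lemma AE_iter_nn_finite:
  assumes h: "h \<in> borel_measurable (lborel_pow (Suc m))" and \<theta>: "\<theta> \<in> extensional {1..n}"
    and fin: "iter_nn (Suc m) s t h \<theta> < \<infinity>"
  shows "AE r in lborel. indicator {s<..<t} r * k r (\<theta> (Suc m)) \<noteq> 0 \<longrightarrow>
    iter_nn m 0 r (\<lambda>x. h (x(Suc m := r))) \<theta> < \<infinity>"
proof -
  note [measurable] = measurable_iter_nn_slice[OF h \<theta>]
  have "AE r in lborel. ennreal (indicator {s<..<t} r * k r (\<theta> (Suc m))) * iter_nn m 0 r (\<lambda>x. h (x(Suc m := r))) \<theta> \<noteq> \<infinity>"
    using fin by (intro nn_integral_PInf_AE) auto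
  then show ?thesis
  proof eventually_elim
    case (elim r)
    show ?case
    proof
      assume "indicator {s<..<t} r * k r (\<theta> (Suc m)) \<noteq> 0"
      then have "0 < indicator {s<..<t} r * k r (\<theta> (Suc m))"
        using k_nonneg[of r "\<theta> (Suc m)"] by (auto simp: indicator_def less_le)
      then show "iter_nn m 0 r (\<lambda>x. h (x(Suc m := r))) \<theta> < \<infinity>"
        using elim by (auto simp: ennreal_mult_eq_top_iff less_top)
    qed
  qed
qed

text \<open>Additivity of the Bochner integral needs integrability at every level. The induction
  hypothesis is available for almost every r of nonzero weight, and the other r contribute
  nothing.\<close>

lemma iter_int_add:
  assumes "f \<in> borel_measurable (lborel_pow m)" "g \<in> borel_measurable (lborel_pow m)"
    and \<theta>: "\<theta> \<in> extensional {1..n}"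
    and "iter_nn m s t (\<lambda>x. ennreal \<bar>f x\<bar>) \<theta> < \<infinity>" "iter_nn m s t (\<lambda>x. ennreal \<bar>g x\<bar>) \<theta> < \<infinity>"
  shows "iter_int m s t (\<lambda>x. f x + g x) \<theta> = iter_int m s t f \<theta> + iter_int m s t g \<theta>"
  using assms(1,2,4,5)
proof (induction m arbitrary: s t f g)
  case (Suc m)
  note fg [measurable] = Suc.prems(1,2)
  note [measurable] = measurable_iter_int_slice[OF fg(1) \<theta>] measurable_iter_int_slice[OF fg(2) \<theta>]
    measurable_iter_int_slice[OF borel_measurable_add[OF fg] \<theta>]
  let ?w = "\<lambda>r. indicator {s<..<t} r * k r (\<theta> (Suc m))"
  have "AE r in lborel. ?w r \<noteq> 0 \<longrightarrow> iter_nn m 0 r (\<lambda>x. ennreal \<bar>f (x(Suc m := r))\<bar>) \<theta> < \<infinity>"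
    by (rule AE_iter_nn_finite[OF _ \<theta> Suc.prems(3)]) measurable
  moreover have "AE r in lborel. ?w r \<noteq> 0 \<longrightarrow> iter_nn m 0 r (\<lambda>x. ennreal \<bar>g (x(Suc m := r))\<bar>) \<theta> < \<infinity>"
    by (rule AE_iter_nn_finite[OF _ \<theta> Suc.prems(4)]) measurable
  ultimately have "AE r in lborel. ?w r * iter_int m 0 r (\<lambda>x. f (x(Suc m := r)) + g (x(Suc m := r))) \<theta>
    = ?w r * iter_int m 0 r (\<lambda>x. f (x(Suc m := r))) \<theta> + ?w r * iter_int m 0 r (\<lambda>x. g (x(Suc m := r))) \<theta>"
  proof eventually_elim
    case (elim r)
    show ?case
    proof (cases "?w r = 0")
      case False
      have "iter_int m 0 r (\<lambda>x. f (x(Suc m := r)) + g (x(Suc m := r))) \<theta>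
        = iter_int m 0 r (\<lambda>x. f (x(Suc m := r))) \<theta> + iter_int m 0 r (\<lambda>x. g (x(Suc m := r))) \<theta>"
        by (intro Suc.IH elim(1)[rule_format] elim(2)[rule_format] False) measurable
      then show ?thesis by (simp only: distrib_left)
    qed (simp only: mult_zero_left add_0_left)
  qed
  then have "iter_int (Suc m) s t (\<lambda>x. f x + g x) \<theta>
    = (\<integral>r. ?w r * iter_int m 0 r (\<lambda>x. f (x(Suc m := r))) \<theta> + ?w r * iter_int m 0 r (\<lambda>x. g (x(Suc m := r))) \<theta> \<partial>lborel)"
    unfolding iter_int.simps by (intro integral_cong_AE) measurable
  also have "\<dots> = iter_int (Suc m) s t f \<theta> + iter_int (Suc m) s t g \<theta>"
    unfolding iter_int.simps
    by (intro Bochner_Integration.integral_add integrable_iter_int[OF _ \<theta>] Suc.prems)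
  finally show ?case .
qed simp

section \<open>The tensorised square-integral estimate\<close>

interpretation product_sigma_finite "\<lambda>_::nat. lborel :: real measure" ..

lemma nn_integral_lborel_pow_Suc:
  assumes [measurable]: "f \<in> borel_measurable (lborel_pow (Suc m))"
  shows "(\<integral>\<^sup>+x. f x \<partial>lborel_pow (Suc m)) = (\<integral>\<^sup>+x. \<integral>\<^sup>+y. f (x(Suc m := y)) \<partial>lborel \<partial>lborel_pow m)"
    and "(\<integral>\<^sup>+x. f x \<partial>lborel_pow (Suc m)) = (\<integral>\<^sup>+y. \<integral>\<^sup>+x. f (x(Suc m := y)) \<partial>lborel_pow m \<partial>lborel)"
proof -
  have "{1..Suc m} = insert (Suc m) {1..m}" by auto
  then show "(\<integral>\<^sup>+x. f x \<partial>lborel_pow (Suc m)) = (\<integral>\<^sup>+x. \<integral>\<^sup>+y. f (x(Suc m := y)) \<partial>lborel \<partial>lborel_pow m)"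
    "(\<integral>\<^sup>+x. f x \<partial>lborel_pow (Suc m)) = (\<integral>\<^sup>+y. \<integral>\<^sup>+x. f (x(Suc m := y)) \<partial>lborel_pow m \<partial>lborel)"
    using product_nn_integral_insert[of "{1..m}" "Suc m" f] product_nn_integral_insert_rev[of "{1..m}" "Suc m" f] assms
    by simp_all
qed

text \<open>Induction on the number of coordinates: the one-dimensional bound acts in the last
  coordinate, Minkowski's inequality exchanges the two norms, and the induction hypothesis acts in
  the remaining coordinates, with lower limit 0 and time limit r.\<close>

lemma iter_nn_L2_bound:
  assumes H: "1/2 < H"
    and emb: "\<And>\<phi>. \<phi> \<in> borel_measurable lborel \<Longrightarrow> (\<And>r. r \<notin> {0<..<T} \<Longrightarrow> \<phi> r = 0) \<Longrightarrow>
      (\<integral>\<^sup>+\<theta>. (\<integral>\<^sup>+r. ennreal (k r \<theta>) * \<phi> r \<partial>lborel)\<^sup>2 \<partial>lborel)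
        \<le> B * ennreal_pow (\<integral>\<^sup>+r. ennreal_pow (\<phi> r) (1 / H) \<partial>lborel) (2 * H)"
    and "f \<in> borel_measurable (lborel_pow m)" "0 \<le> s" "t \<le> T"
  shows "(\<integral>\<^sup>+\<theta>. (iter_nn m s t f \<theta>)\<^sup>2 \<partial>lborel_pow m)
    \<le> B ^ m * ennreal_pow (\<integral>\<^sup>+x. ennreal_pow (f x) (1 / H) \<partial>lborel_pow m) (2 * H)"
  using assms(3-)
proof (induction m arbitrary: s t f)
  case 0
  \<comment> \<open>The product measure over the empty index set is a point mass at the constant
    function \<open>undefined\<close>, and since (1/H) * 2H = 2 both sides are the square of f
    there.\<close>
  have "{1..0::nat} = {}" by simp
  then show ?case
    unfolding iter_nn.simps power_0 mult_1
    using H by (simp only: nn_integral_empty zero_le ennreal_pow_pow) (simp add: ennreal_pow_2)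
next
  case (Suc m)
  note [measurable] = Suc.prems(1)
  let ?w = "\<lambda>r. indicator {s<..<t} r :: ennreal"
  define G where "G x r = ?w r * iter_nn m 0 r (\<lambda>x. f (x(Suc m := r))) x" for x r
  have w: "?w \<in> borel_measurable lborel" by simp
  have G [measurable]: "case_prod G \<in> borel_measurable (lborel_pow m \<Otimes>\<^sub>M lborel)"
    using borel_measurable_times_ennreal[OF
      measurable_compose[OF measurable_snd w]
      measurable_compose[OF measurable_Pair[OF measurable_snd measurable_fst]
        measurable_iter_nn_step[OF Suc.prems(1), of 0 m]]]
    unfolding G_def split_beta fst_conv snd_conv .
  \<comment> \<open>The inner integral does not read coordinate \<open>Suc m\<close>, so x and y
    separate: for fixed x this is the one-dimensional operator applied to \<open>G x\<close> and
    evaluated at y.\<close>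
  have iter_upd: "iter_nn (Suc m) s t f (x(Suc m := y)) = (\<integral>\<^sup>+r. ennreal (k r y) * G x r \<partial>lborel)" for x y
  proof -
    have "Suc m \<notin> {1..m}" by simp
    show ?thesis
      unfolding iter_nn.simps G_def iter_nn_cong_upd[OF \<open>Suc m \<notin> {1..m}\<close>]
      by (intro nn_integral_cong) (simp add: ennreal_mult ennreal_indicator k_nonneg mult_ac)
  qed
  have GH: "(\<lambda>(x, r). ennreal_pow (G x r) (1 / H)) \<in> borel_measurable (lborel_pow m \<Otimes>\<^sub>M lborel)"
    by measurable
  have Gx: "G x \<in> borel_measurable lborel" if "x \<in> space (lborel_pow m)" for x
    using measurable_compose[OF measurable_Pair1'[OF that] G] by simp
  interpret pair_sigma_finite "lborel_pow m" "lborel :: real measure"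
    by (intro pair_sigma_finite.intro sigma_finite lborel.sigma_finite_measure_axioms) simp
  have "(\<integral>\<^sup>+\<theta>. (iter_nn (Suc m) s t f \<theta>)\<^sup>2 \<partial>lborel_pow (Suc m))
      = (\<integral>\<^sup>+x. \<integral>\<^sup>+y. (\<integral>\<^sup>+r. ennreal (k r y) * G x r \<partial>lborel)\<^sup>2 \<partial>lborel \<partial>lborel_pow m)"
    unfolding iter_upd[symmetric]
    by (rule nn_integral_lborel_pow_Suc(1))
      (unfold power2_eq_square, intro borel_measurable_times_ennreal measurable_iter_nn Suc.prems)
  also have "\<dots> \<le> (\<integral>\<^sup>+x. B * ennreal_pow (\<integral>\<^sup>+r. ennreal_pow (G x r) (1 / H) \<partial>lborel) (2 * H) \<partial>lborel_pow m)"
    using Suc.prems by (intro nn_integral_mono emb Gx) (auto simp: G_def indicator_def)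
  also have "\<dots> = B * (\<integral>\<^sup>+x. ennreal_pow (\<integral>\<^sup>+r. ennreal_pow (G x r) (1 / H) \<partial>lborel) (2 * H) \<partial>lborel_pow m)"
    by (intro nn_integral_cmult) measurable
  \<comment> \<open>Minkowski with exponent 2H > 1 is applied to the (1/H)-th power of
    \<open>G\<close>. The norm of exponent 1/H in r inside the one of exponent 2 in x becomes
    exponent 2 in x inside exponent 1/H in r, which the induction hypothesis controls for each
    r.\<close>
  also have "\<dots> \<le> B * ennreal_pow (\<integral>\<^sup>+r. ennreal_pow (\<integral>\<^sup>+x. ennreal_pow (ennreal_pow (G x r) (1 / H)) (2 * H) \<partial>lborel_pow m) (1 / (2 * H)) \<partial>lborel) (2 * H)"
    using H by (intro mult_left_mono Minkowski_integral GH) auto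
  also have "\<dots> = B * ennreal_pow (\<integral>\<^sup>+r. ennreal_pow (\<integral>\<^sup>+x. (G x r)\<^sup>2 \<partial>lborel_pow m) (1 / (2 * H)) \<partial>lborel) (2 * H)"
    using H by (simp add: ennreal_pow_pow ennreal_pow_2)
  also have "\<dots> \<le> B * ennreal_pow (\<integral>\<^sup>+r. ennreal_pow (B ^ m) (1 / (2 * H)) *
      (\<integral>\<^sup>+x. ennreal_pow (f (x(Suc m := r))) (1 / H) \<partial>lborel_pow m) \<partial>lborel) (2 * H)"
  proof (intro mult_left_mono ennreal_pow_mono nn_integral_mono)
    fix r :: real
    show "ennreal_pow (\<integral>\<^sup>+x. (G x r)\<^sup>2 \<partial>lborel_pow m) (1 / (2 * H))
      \<le> ennreal_pow (B ^ m) (1 / (2 * H)) * (\<integral>\<^sup>+x. ennreal_pow (f (x(Suc m := r))) (1 / H) \<partial>lborel_pow m)"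
    proof (cases "r \<in> {s<..<t}")
      case True
      then have Gr: "G x r = iter_nn m 0 r (\<lambda>x. f (x(Suc m := r))) x" for x
        by (simp add: G_def)
      have "(\<integral>\<^sup>+x. (G x r)\<^sup>2 \<partial>lborel_pow m)
        \<le> B ^ m * ennreal_pow (\<integral>\<^sup>+x. ennreal_pow (f (x(Suc m := r))) (1 / H) \<partial>lborel_pow m) (2 * H)"
        unfolding Gr using True Suc.prems(2,3)
        by (intro Suc.IH measurable_compose[OF measurable_insert_coord Suc.prems(1)]) auto
      then have "ennreal_pow (\<integral>\<^sup>+x. (G x r)\<^sup>2 \<partial>lborel_pow m) (1 / (2 * H))
        \<le> ennreal_pow (B ^ m * ennreal_pow (\<integral>\<^sup>+x. ennreal_pow (f (x(Suc m := r))) (1 / H) \<partial>lborel_pow m) (2 * H)) (1 / (2 * H))"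
        using H by (intro ennreal_pow_mono) auto
      also have "\<dots> = ennreal_pow (B ^ m) (1 / (2 * H)) * (\<integral>\<^sup>+x. ennreal_pow (f (x(Suc m := r))) (1 / H) \<partial>lborel_pow m)"
        using H by (simp add: ennreal_pow_mult ennreal_pow_pow)
      finally show ?thesis .
    qed (simp add: G_def)
  qed (use H in auto)
  also have "(\<integral>\<^sup>+r. ennreal_pow (B ^ m) (1 / (2 * H)) *
      (\<integral>\<^sup>+x. ennreal_pow (f (x(Suc m := r))) (1 / H) \<partial>lborel_pow m) \<partial>lborel)
    = ennreal_pow (B ^ m) (1 / (2 * H)) * (\<integral>\<^sup>+r. \<integral>\<^sup>+x. ennreal_pow (f (x(Suc m := r))) (1 / H) \<partial>lborel_pow m \<partial>lborel)"
    using measurable_ennreal_pow[OF measurable_compose[OF measurable_insert_coord_pair Suc.prems(1)], of "1 / H"]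
    unfolding split_beta
    by (intro nn_integral_cmult M1.borel_measurable_nn_integral) (unfold split_beta)
  also have "(\<integral>\<^sup>+r. \<integral>\<^sup>+x. ennreal_pow (f (x(Suc m := r))) (1 / H) \<partial>lborel_pow m \<partial>lborel)
    = (\<integral>\<^sup>+x. ennreal_pow (f x) (1 / H) \<partial>lborel_pow (Suc m))"
    by (rule nn_integral_lborel_pow_Suc(2)[symmetric]) measurable
  \<comment> \<open>The constant left the inner integral with exponent 1/(2H); the outer exponent 2H
    restores it to B^m.\<close>
  also have "B * ennreal_pow (ennreal_pow (B ^ m) (1 / (2 * H)) * (\<integral>\<^sup>+x. ennreal_pow (f x) (1 / H) \<partial>lborel_pow (Suc m))) (2 * H)
    = B ^ Suc m * ennreal_pow (\<integral>\<^sup>+x. ennreal_pow (f x) (1 / H) \<partial>lborel_pow (Suc m)) (2 * H)"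
    using H by (simp add: ennreal_pow_mult ennreal_pow_pow mult.assoc)
  finally show ?case .
qed

end

section \<open>The operators \<open>K\<^sup>*\<close> as iterated integrals\<close>

locale fractional_kernel = volterra_kernel k for k +
  fixes c H :: real
  assumes k_pos: "0 < \<theta> \<Longrightarrow> \<theta> < r \<Longrightarrow> 0 < k r \<theta>"
    and dKH_k: "0 < \<theta> \<Longrightarrow> \<theta> < r \<Longrightarrow> dKH c H r \<theta> = k r \<theta>"
begin

text \<open>\<open>S\<close> stands for the various integration intervals in \<open>Kstar\<close>.
  The hypotheses let it differ from ]s,t[ only where the kernel or \<open>X\<close>
  vanishes.\<close>

lemma set_integral_dKH:
  assumes "0 < x" "\<And>r. r \<in> S \<Longrightarrow> s < r \<and> r < t \<and> x < r"
    and "\<And>r. s < r \<Longrightarrow> r < t \<Longrightarrow> x < r \<Longrightarrow> X r \<noteq> 0 \<Longrightarrow> r \<in> S"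
  shows "(LBINT r:S. X r * dKH c H r x) = (\<integral>r. indicator {s<..<t} r * k r x * X r \<partial>lborel)"
  unfolding set_lebesgue_integral_def
proof (intro Bochner_Integration.integral_cong refl)
  fix r
  show "indicator S r *\<^sub>R (X r * dKH c H r x) = indicator {s<..<t} r * k r x * X r"
  proof (cases "r \<in> S")
    case True
    then show ?thesis using assms(1) assms(2)[OF True] by (simp add: dKH_k)
  next
    case False
    then show ?thesis using assms(3)[of r] k_eq_0[of x r] by (auto simp: indicator_def)
  qed
qed

lemma set_integrable_dKH:
  assumes "0 < x" "\<And>r. r \<in> S \<Longrightarrow> s < r \<and> r < t \<and> x < r" "S \<in> sets lborel"
    and "integrable lborel (\<lambda>r. indicator {s<..<t} r * k r x * X r)"
  shows "set_integrable lborel S (\<lambda>r. X r * dKH c H r x)"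
proof -
  have "indicator S r *\<^sub>R (X r * dKH c H r x) = indicator S r *\<^sub>R (indicator {s<..<t} r * k r x * X r)" for r
    using assms(1) assms(2)[of r] by (cases "r \<in> S") (simp_all add: dKH_k)
  then show ?thesis
    unfolding set_integrable_def by (simp only: integrable_mult_indicator assms(3,4))
qed

text \<open>The first term of \<open>Kstar\<close> is active for \<theta> n > s and the second for
  \<theta> n < s; each equals the iterated integral there. At \<theta> n = s both indicators vanish
  but the iterated integral may not, hence the factor \<open>of_bool\<close>.\<close>

lemma Kstar_eq_iter_int:
  assumes "1 \<le> n" "0 \<le> s"
  shows "Kstar c H n s t h \<theta> = of_bool (\<theta> n \<noteq> s) * iter_int n s t h \<theta>"
  using assms
proof (induction n arbitrary: s t h rule: nat_induct_at_least)
  case base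
  let ?x = "\<theta> (Suc 0)"
  consider "?x = s" | "?x \<noteq> s" "?x \<le> 0 \<or> t \<le> ?x" | "0 < ?x" "?x < s" "?x < t" | "0 < ?x" "s < ?x" "?x < t"
    by linarith
  then show ?case
  proof cases
    case 2
    then have "iter_int 1 s t h \<theta> = 0"
      by (intro iter_int_eq_0[of 1]) auto
    then show ?thesis using 2 base by (cases "t \<le> s") (auto simp: set_lebesgue_integral_def)
  next
    case 3
    then have "(LBINT r:{s<..<t}. h ((\<lambda>_. undefined)(Suc 0 := r)) * dKH c H r ?x) = iter_int 1 s t h \<theta>"
      unfolding One_nat_def iter_int.simps by (intro set_integral_dKH) auto
    then show ?thesis using 3 by simp
  next
    case 4
    then have "(LBINT r:{?x<..<t}. h ((\<lambda>_. undefined)(Suc 0 := r)) * dKH c H r ?x) = iter_int 1 s t h \<theta>"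
      unfolding One_nat_def iter_int.simps by (intro set_integral_dKH) auto
    then show ?thesis using 4 by simp
  qed simp
next
  case (Suc n)
  then obtain m where n: "n = Suc m" by (cases n) auto
  let ?x = "\<theta> (Suc n)"
  let ?X = "\<lambda>r. Kstar c H n 0 r (\<lambda>x. h (x(Suc n := r))) \<theta>"
  \<comment> \<open>With lower limit 0 the factor \<open>of_bool\<close> disappears, because the
    iterated integral vanishes at \<theta> n = 0.\<close>
  have X: "?X r = iter_int n 0 r (\<lambda>x. h (x(Suc n := r))) \<theta>" for r
    using iter_int_eq_0[of n n \<theta> r] Suc.hyps by (auto simp: Suc.IH)
  have X0: "\<theta> i < r" if "?X r \<noteq> 0" "i \<in> {1..n}" for i r
    using that iter_int_eq_0[of i n \<theta> r] by (auto simp: X)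
  have Max1: "Max (\<theta> ` {1..n}) < r \<longleftrightarrow> (\<forall>i\<in>{1..n}. \<theta> i < r)" for r
    using Suc.hyps by (subst Max_less_iff) auto
  have Max2: "Max (\<theta> ` {1..Suc n}) < r \<longleftrightarrow> (\<forall>i\<in>{1..n}. \<theta> i < r) \<and> ?x < r" for r
    by (subst Max_less_iff) (auto simp: le_Suc_eq)
  have Kstar_Suc: "Kstar c H (Suc n) s t h \<theta> =
     (LBINT r:{Max (\<theta> ` {1..Suc n})<..<t}. ?X r * dKH c H r ?x)
        * of_bool (\<forall>i\<in>{1..n}. \<theta> i \<in> {0..t}) * indicator {s<..<t} ?x
   + (LBINT r:{max (Max (\<theta> ` {1..n})) s<..<t}. ?X r * dKH c H r ?x)
        * of_bool (\<forall>i\<in>{1..n}. \<theta> i \<in> {0..t}) * indicator {0<..<s} ?x * of_bool (s \<noteq> 0)"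
    unfolding n Kstar.simps Let_def by simp
  consider "?x = s" | "?x \<noteq> s" "?x \<le> 0 \<or> t \<le> ?x" | i where "i \<in> {1..n}" "\<theta> i \<notin> {0..t}"
    | "0 < ?x" "?x < s" "?x < t" "\<forall>i\<in>{1..n}. \<theta> i \<in> {0..t}"
    | "0 < ?x" "s < ?x" "?x < t" "\<forall>i\<in>{1..n}. \<theta> i \<in> {0..t}"
    by force
  then show ?case
  proof cases
    case 1
    then show ?thesis unfolding Kstar_Suc by simp
  next
    case 2
    then have "iter_int (Suc n) s t h \<theta> = 0"
      by (intro iter_int_eq_0[of "Suc n"]) auto
    \<comment> \<open>The order of s and t is left open. For t <= s the indicator of ]0,s[ may be 1
      although \<theta> n >= t, but then the integration interval is empty.\<close>
    moreover have "{max M s<..<t} = {}" if "t \<le> s" for M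
      using that by auto
    ultimately show ?thesis using 2 Suc.prems unfolding Kstar_Suc
      by (cases "t \<le> s") (auto simp: set_lebesgue_integral_def simp del: iter_int.simps)
  next
    case 3
    then have "iter_int (Suc n) s t h \<theta> = 0"
      by (intro iter_int_eq_0[of i]) auto
    then show ?thesis using 3 unfolding Kstar_Suc by (auto simp del: iter_int.simps)
  next
    case 4
    have mem: "r \<in> {max (Max (\<theta> ` {1..n})) s<..<t}" if "s < r" "r < t" "?X r \<noteq> 0" for r
    proof -
      have "Max (\<theta> ` {1..n}) < r"
        unfolding Max1 using X0[OF that(3)] by blast
      then show ?thesis using that by simp
    qed
    have "(LBINT r:{max (Max (\<theta> ` {1..n})) s<..<t}. ?X r * dKH c H r ?x) = iter_int (Suc n) s t h \<theta>"
      unfolding iter_int.simps X[symmetric]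
      by (intro set_integral_dKH mem) (use 4 in auto)
    then show ?thesis using 4 unfolding Kstar_Suc by (simp del: iter_int.simps)
  next
    case 5
    have mem: "r \<in> {Max (\<theta> ` {1..Suc n})<..<t}" if "r < t" "?x < r" "?X r \<noteq> 0" for r
    proof -
      have "Max (\<theta> ` {1..Suc n}) < r"
        unfolding Max2 using X0[OF that(3)] that(2) by blast
      then show ?thesis using that by simp
    qed
    have bounds: "s < r \<and> r < t \<and> ?x < r" if r: "r \<in> {Max (\<theta> ` {1..Suc n})<..<t}" for r
    proof -
      have "Max (\<theta> ` {1..Suc n}) < r" "r < t" using r by simp_all
      then have "?x < r" using Max2 by blast
      then show ?thesis using 5 \<open>r < t\<close> by simp
    qed
    have "(LBINT r:{Max (\<theta> ` {1..Suc n})<..<t}. ?X r * dKH c H r ?x) = iter_int (Suc n) s t h \<theta>"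
      unfolding iter_int.simps X[symmetric]
      by (rule set_integral_dKH[OF _ bounds mem]) (use 5 in auto)
    then show ?thesis using 5 unfolding Kstar_Suc by (simp del: iter_int.simps)
  qed
qed

lemma Kstar_0_eq_iter_int: "1 \<le> n \<Longrightarrow> Kstar c H n 0 t h \<theta> = iter_int n 0 t h \<theta>"
  using iter_int_eq_0[of n n \<theta> t 0 h] by (auto simp: Kstar_eq_iter_int)

lemma Kstar_cong_simplex:
  assumes "\<And>x. x \<in> ord_simplex n t \<Longrightarrow> h x = h' x" "0 \<le> s" "1 \<le> n"
  shows "Kstar c H n s t h \<theta> = Kstar c H n s t h' \<theta>"
  using iter_int_cong_simplex[of n t s h h' \<theta>] assms by (simp add: Kstar_eq_iter_int)

text \<open>This transports definedness from the extension of h by 0, which is measurable on the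
  whole product space, back to h, which is given only on the simplex.\<close>

lemma Kstar_defined_cong_simplex:
  assumes "\<And>x. x \<in> ord_simplex n t \<Longrightarrow> h x = h' x" "0 \<le> s" "1 \<le> n"
  shows "Kstar_defined c H n s t h \<theta> = Kstar_defined c H n s t h' \<theta>"
  using assms(3,1,2)
proof (induction n arbitrary: s t h h' rule: nat_induct_at_least)
  case base
  have "h ((\<lambda>_. undefined)(Suc 0 := r)) = h' ((\<lambda>_. undefined)(Suc 0 := r))" if "0 < r" "r < t" for r
    using base.prems(1) upd_undefined_in_ord_simplex[of r t] that by simp
  then have int_cong: "set_integrable lborel S (\<lambda>r. h ((\<lambda>_. undefined)(Suc 0 := r)) * dKH c H r (\<theta> (Suc 0)))
      = set_integrable lborel S (\<lambda>r. h' ((\<lambda>_. undefined)(Suc 0 := r)) * dKH c H r (\<theta> (Suc 0)))"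
    if "S \<subseteq> {0<..<t}" for S
    by (intro set_integrable_cong) (use that in auto)
  show ?case
    unfolding One_nat_def Kstar_defined.simps
    by (intro conj_cong imp_cong refl int_cong) (use base.prems(2) in auto)
next
  case (Suc n)
  then obtain m where n: "n = Suc m" by (cases n) auto
  have 1: "Kstar c H n 0 r (\<lambda>x. h (x(Suc n := r))) \<theta> = Kstar c H n 0 r (\<lambda>x. h' (x(Suc n := r))) \<theta>"
    if "r < t" for r
    using that Suc.hyps by (intro Kstar_cong_simplex Suc.prems upd_in_ord_simplex) auto
  have 2: "Kstar_defined c H n 0 r (\<lambda>x. h (x(Suc n := r))) \<theta> = Kstar_defined c H n 0 r (\<lambda>x. h' (x(Suc n := r))) \<theta>"
    if "r < t" for r
    using that Suc.hyps by (intro Suc.IH Suc.prems upd_in_ord_simplex) auto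
  show ?case
    unfolding n Kstar_defined.simps Let_def
    using 1 2 unfolding n
    by (intro imp_cong conj_cong refl set_integrable_cong AE_cong) (simp_all del: Kstar.simps Kstar_defined.simps)
qed

text \<open>Finiteness of the iterated integral of the absolute value gives integrability at the
  outer level and is inherited by the inner levels for almost every r.\<close>

lemma Kstar_definedI:
  assumes "h \<in> borel_measurable (lborel_pow n)" "\<theta> \<in> extensional {1..N}" "0 \<le> s" "1 \<le> n"
    and "iter_nn n s t (\<lambda>x. ennreal \<bar>h x\<bar>) \<theta> < \<infinity>"
  shows "Kstar_defined c H n s t h \<theta>"
  using assms(4,1,3,5)
proof (induction n arbitrary: s t h rule: nat_induct_at_least)
  case base
  have int: "integrable lborel (\<lambda>r. indicator {s<..<t} r * k r (\<theta> (Suc 0)) * h ((\<lambda>_. undefined)(Suc 0 := r)))"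
    using integrable_iter_int[of h 0 \<theta> N s t] base.prems assms(2) by simp
  show ?case
    using base.prems(2) by (auto intro!: set_integrable_dKH[OF _ _ _ int])
next
  case (Suc n)
  then obtain m where n: "n = Suc m" by (cases n) auto
  let ?x = "\<theta> (Suc n)"
  have int: "integrable lborel (\<lambda>r. indicator {s<..<t} r * k r ?x * Kstar c H n 0 r (\<lambda>x. h (x(Suc n := r))) \<theta>)"
    using integrable_iter_int[of h n \<theta> N s t] Suc.prems assms(2) Suc.hyps by (simp only: Kstar_0_eq_iter_int)
  have meas: "(\<lambda>x. ennreal \<bar>h x\<bar>) \<in> borel_measurable (lborel_pow (Suc n))"
    using Suc.prems(1) by measurable
  \<comment> \<open>On this range the kernel is strictly positive, so the weight does not vanish and
    the inner integral is finite for almost every such r.\<close>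
  have AE: "AE r in lborel. s < r \<longrightarrow> r < t \<longrightarrow> 0 < ?x \<longrightarrow> ?x < r \<longrightarrow> Kstar_defined c H n 0 r (\<lambda>x. h (x(Suc n := r))) \<theta>"
    using AE_iter_nn_finite[OF meas assms(2) Suc.prems(3)]
  proof eventually_elim
    case (elim r)
    show ?case
    proof (intro impI Suc.IH)
      assume r: "s < r" "r < t" "0 < ?x" "?x < r"
      show "(\<lambda>x. h (x(Suc n := r))) \<in> borel_measurable (lborel_pow n)"
        by (rule measurable_compose[OF measurable_insert_coord Suc.prems(1)])
      show "iter_nn n 0 r (\<lambda>x. ennreal \<bar>h (x(Suc n := r))\<bar>) \<theta> < \<infinity>"
        using r k_pos[of ?x r] by (intro elim[rule_format]) auto
    qed simp
  qed
  have Max2: "Max (\<theta> ` {1..Suc n}) < r \<longleftrightarrow> (\<forall>i\<in>{1..n}. \<theta> i < r) \<and> ?x < r" for r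
    by (subst Max_less_iff) (auto simp: le_Suc_eq)
  have L: "s < r \<and> r < t \<and> ?x < r" if x: "?x \<in> {s<..<t}" and r: "r \<in> {Max (\<theta> ` {1..Suc n})<..<t}" for r
  proof -
    have "Max (\<theta> ` {1..Suc n}) < r" "r < t" using r by simp_all
    then have "?x < r" using Max2 by blast
    then show ?thesis using x \<open>r < t\<close> by simp
  qed
  have 1: "set_integrable lborel {Max (\<theta> ` {1..Suc n})<..<t}
        (\<lambda>r. Kstar c H n 0 r (\<lambda>x. h (x(Suc n := r))) \<theta> * dKH c H r ?x)
      \<and> (AE r in lborel. r \<in> {Max (\<theta> ` {1..Suc n})<..<t} \<longrightarrow> Kstar_defined c H n 0 r (\<lambda>x. h (x(Suc n := r))) \<theta>)"
    if "?x \<in> {s<..<t}"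
  proof
    show "set_integrable lborel {Max (\<theta> ` {1..Suc n})<..<t}
        (\<lambda>r. Kstar c H n 0 r (\<lambda>x. h (x(Suc n := r))) \<theta> * dKH c H r ?x)"
      using that Suc.prems(2)
      by (intro set_integrable_dKH[OF _ L[OF that] _ int]) auto
    show "AE r in lborel. r \<in> {Max (\<theta> ` {1..Suc n})<..<t} \<longrightarrow> Kstar_defined c H n 0 r (\<lambda>x. h (x(Suc n := r))) \<theta>"
      using AE
    proof eventually_elim
      case (elim r)
      show ?case
      proof
        assume "r \<in> {Max (\<theta> ` {1..Suc n})<..<t}"
        from L[OF that this] show "Kstar_defined c H n 0 r (\<lambda>x. h (x(Suc n := r))) \<theta>"
          using that Suc.prems(2) by (intro elim[rule_format]) auto
      qed
    qed
  qed
  have 2: "set_integrable lborel {max (Max (\<theta> ` {1..n})) s<..<t}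
        (\<lambda>r. Kstar c H n 0 r (\<lambda>x. h (x(Suc n := r))) \<theta> * dKH c H r ?x)
      \<and> (AE r in lborel. r \<in> {max (Max (\<theta> ` {1..n})) s<..<t} \<longrightarrow> Kstar_defined c H n 0 r (\<lambda>x. h (x(Suc n := r))) \<theta>)"
    if "?x \<in> {0<..<s}"
  proof
    show "set_integrable lborel {max (Max (\<theta> ` {1..n})) s<..<t}
        (\<lambda>r. Kstar c H n 0 r (\<lambda>x. h (x(Suc n := r))) \<theta> * dKH c H r ?x)"
      using that
      by (intro set_integrable_dKH[OF _ _ _ int]) auto
    show "AE r in lborel. r \<in> {max (Max (\<theta> ` {1..n})) s<..<t} \<longrightarrow> Kstar_defined c H n 0 r (\<lambda>x. h (x(Suc n := r))) \<theta>"
      using AE by eventually_elim (use that in auto)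
  qed
  show ?case
    unfolding n Kstar_defined.simps Let_def diff_Suc_1
    using 1 2 unfolding n by blast
qed

end

section \<open>Bounds on the simplex\<close>

declare One_nat_def [simp del]

lemma space_lborel_pow: "space (lborel_pow n) = extensional {1..n}"
  by (auto simp: space_PiM PiE_def)

lemma cube_in_sets: "cube n t \<in> sets (lborel_pow n)"
  unfolding cube_def by (rule sets_PiM_I_finite) auto

lemma ord_simplex_in_sets:
  assumes "1 \<le> n"
  shows "ord_simplex n t \<in> sets (lborel_pow n)"
proof -
  have c: "(\<lambda>x. x i) \<in> borel_measurable (lborel_pow n)" if "i \<in> {1..n}" for i
    using measurable_component_singleton[OF that, of "\<lambda>_. lborel"] by simp
  have "{x \<in> space (lborel_pow n). 0 \<le> x 1 \<and> (\<forall>i\<in>{1..<n}. x i \<le> x (Suc i)) \<and> x n \<le> t} \<in> sets (lborel_pow n)"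
    using assms
    by (intro sets.sets_Collect_conj sets.sets_Collect_finite_All borel_measurable_le c borel_measurable_const) auto
  then show ?thesis
    by (simp add: space_lborel_pow ord_simplex_def)
qed

lemma ord_simplex_mono: "t \<le> t' \<Longrightarrow> ord_simplex n t \<subseteq> ord_simplex n t'"
  by (auto simp: ord_simplex_def)

lemma ord_simplex_bounds:
  assumes x: "x \<in> ord_simplex n t" and i: "i \<in> {1..n}"
  shows "0 \<le> x i" "x i \<le> t"
proof -
  have mono: "x j \<le> x l" if "j \<le> l" "1 \<le> j" "l \<le> n" for j l
    using that
  proof (induction l rule: dec_induct)
    case (step l)
    then have "x l \<le> x (Suc l)" using x by (simp add: ord_simplex_def)
    with step show ?case by simp
  qed simp
  have "x 1 \<le> x i" "x i \<le> x n"
    using i by (auto intro: mono)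
  then show "0 \<le> x i" "x i \<le> t"
    using x by (auto simp: ord_simplex_def)
qed

lemma measurable_times_indicator_simplex:
  fixes h :: "(nat \<Rightarrow> real) \<Rightarrow> real"
  assumes "h \<in> borel_measurable (lborel_on n (ord_simplex n T))" "1 \<le> n" "t \<le> T"
  shows "(\<lambda>x. h x * indicator (ord_simplex n t) x) \<in> borel_measurable (lborel_pow n)"
proof -
  have "(\<lambda>x. indicator (ord_simplex n T) x *\<^sub>R h x) \<in> borel_measurable (lborel_pow n)"
    using assms by (subst (asm) borel_measurable_restrict_space_iff) (auto intro: ord_simplex_in_sets)
  then have "(\<lambda>x. indicator (ord_simplex n T) x *\<^sub>R h x * indicator (ord_simplex n t) x) \<in> borel_measurable (lborel_pow n)"
    using ord_simplex_in_sets[OF assms(2), of t] by (intro borel_measurable_times) auto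
  also have "(\<lambda>x. indicator (ord_simplex n T) x *\<^sub>R h x * indicator (ord_simplex n t) x)
      = (\<lambda>x. h x * indicator (ord_simplex n t) x)"
    using ord_simplex_mono[OF assms(3)] by (auto simp: fun_eq_iff indicator_def)
  finally show ?thesis .
qed

lemma nn_integral_lborel_on:
  "A \<in> sets (lborel_pow n) \<Longrightarrow> (\<integral>\<^sup>+x. f x \<partial>lborel_on n A) = (\<integral>\<^sup>+x. f x * indicator A x \<partial>lborel_pow n)"
  by (rule nn_integral_restrict_space) auto

text \<open>\<open>dKH\<close> is a \<open>deriv\<close> and is computed only on the triangle 0 <
  \<theta> < r. The explicit formula, extended by 0, is a globally measurable kernel that agrees
  with it there.\<close>

definition frac_kernel :: "real \<Rightarrow> real \<Rightarrow> real \<Rightarrow> real \<Rightarrow> real" where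
  "frac_kernel c H r \<theta> = (if 0 < \<theta> \<and> \<theta> < r
     then c * (H - 1/2) * (\<theta> / r) powr (1/2 - H) * (r - \<theta>) powr (H - 3/2) else 0)"

lemma fractional_kernel_frac_kernel:
  assumes "0 < c" "1/2 < H"
  shows "fractional_kernel (frac_kernel c H) c H"
proof
  show "0 \<le> frac_kernel c H r \<theta>" for r \<theta>
    using assms by (auto simp: frac_kernel_def intro!: mult_nonneg_nonneg)
  show "(\<lambda>(r, \<theta>). frac_kernel c H r \<theta>) \<in> borel_measurable (lborel \<Otimes>\<^sub>M lborel)"
    unfolding frac_kernel_def by measurable
  show "0 < frac_kernel c H r \<theta>" if "0 < \<theta>" "\<theta> < r" for r \<theta>
    using assms that by (auto simp: frac_kernel_def intro!: mult_pos_pos)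
  show "dKH c H r \<theta> = frac_kernel c H r \<theta>" if "0 < \<theta>" "\<theta> < r" for r \<theta>
    using dKH_eq[of H \<theta> r c] assms that by (simp add: frac_kernel_def)
qed (auto simp: frac_kernel_def)

section \<open>The embedding inequality for extended-valued functions\<close>

context fractional_kernel begin

text \<open>The embedding hypothesis speaks of real functions on [0,T], whereas the induction
  applies it to iterated integrals that may be infinite. If the right side is finite, \<phi> is
  finite almost everywhere and can be replaced by a real function; otherwise b > 0 makes the bound
  trivial.\<close>

lemma embedding_ennreal:
  assumes H: "0 < H" and b: "0 < b" and emb: "embedding_constant c H T b"
    and [measurable]: "\<phi> \<in> borel_measurable lborel" and \<phi>0: "\<And>r. r \<notin> {0<..<T} \<Longrightarrow> \<phi> r = 0"
  shows "(\<integral>\<^sup>+\<theta>. (\<integral>\<^sup>+r. ennreal (k r \<theta>) * \<phi> r \<partial>lborel)\<^sup>2 \<partial>lborel)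
    \<le> (ennreal b)\<^sup>2 * ennreal_pow (\<integral>\<^sup>+r. ennreal_pow (\<phi> r) (1 / H) \<partial>lborel) (2 * H)"
proof (cases "(\<integral>\<^sup>+r. ennreal_pow (\<phi> r) (1 / H) \<partial>lborel) = top")
  case True
  then show ?thesis using b by (simp add: ennreal_mult_top ennreal_power)
next
  case False
  have "AE r in lborel. ennreal_pow (\<phi> r) (1 / H) \<noteq> \<infinity>"
    using False by (intro nn_integral_PInf_AE) auto
  then have fin: "AE r in lborel. \<phi> r = ennreal (enn2real (\<phi> r))"
    by eventually_elim (simp add: less_top)
  define \<psi> where "\<psi> r = enn2real (\<phi> r)" for r
  have \<psi>: "\<psi> \<in> borel_measurable (restrict_space lborel {0..T})"
    unfolding \<psi>_def by (intro measurable_restrict_space1) measurable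
  \<comment> \<open>Restricting r to ]\<theta>,T[ loses nothing: the kernel vanishes for r <=
    \<theta>, and \<phi> vanishes for r >= T.\<close>
  have inner: "(\<integral>\<^sup>+r\<in>{\<theta><..<T}. ennreal (\<bar>\<psi> r\<bar> * dKH c H r \<theta>) \<partial>lborel) = (\<integral>\<^sup>+r. ennreal (k r \<theta>) * \<phi> r \<partial>lborel)"
    if "0 < \<theta>" for \<theta>
  proof (intro nn_integral_cong_AE, use fin in eventually_elim)
    case (elim r)
    show ?case
    proof (cases "r \<in> {\<theta><..<T}")
      case True
      then have "ennreal (\<bar>\<psi> r\<bar> * dKH c H r \<theta>) = ennreal (k r \<theta>) * ennreal (\<psi> r)"
        using that by (simp add: dKH_k \<psi>_def k_nonneg ennreal_mult mult.commute)
      then show ?thesis using True elim by (simp add: \<psi>_def)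
    next
      case False
      then have "k r \<theta> = 0 \<or> \<phi> r = 0"
        using k_eq_0[of \<theta> r] \<phi>0[of r] by auto
      then show ?thesis using False by auto
    qed
  qed
  have "(\<integral>\<^sup>+\<theta>. (\<integral>\<^sup>+r. ennreal (k r \<theta>) * \<phi> r \<partial>lborel)\<^sup>2 \<partial>lborel)
    = (\<integral>\<^sup>+\<theta>\<in>{0<..<T}. (\<integral>\<^sup>+r\<in>{\<theta><..<T}. ennreal (\<bar>\<psi> r\<bar> * dKH c H r \<theta>) \<partial>lborel)\<^sup>2 \<partial>lborel)"
  proof (intro nn_integral_cong)
    fix \<theta> :: real
    show "(\<integral>\<^sup>+r. ennreal (k r \<theta>) * \<phi> r \<partial>lborel)\<^sup>2
      = (\<integral>\<^sup>+r\<in>{\<theta><..<T}. ennreal (\<bar>\<psi> r\<bar> * dKH c H r \<theta>) \<partial>lborel)\<^sup>2 * indicator {0<..<T} \<theta>"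
    proof (cases "\<theta> \<in> {0<..<T}")
      case True
      then show ?thesis using inner[of \<theta>] by simp
    next
      case False
      have "(\<integral>\<^sup>+r. ennreal (k r \<theta>) * \<phi> r \<partial>lborel) = (\<integral>\<^sup>+(r::real). 0 \<partial>lborel)"
      proof (intro nn_integral_cong)
        show "ennreal (k r \<theta>) * \<phi> r = 0" for r
          using False k_eq_0[of \<theta> r] \<phi>0[of r] by (cases "r \<in> {0<..<T}") auto
      qed
      then show ?thesis using False by simp
    qed
  qed
  also have "\<dots> = ennreal_pow (abs_HH_norm c H T \<psi>) 2"
    by (simp add: abs_HH_norm_def ennreal_pow_pow)
  also have "\<dots> \<le> ennreal_pow (ennreal b * Lp_norm (1 / H) (restrict_space lborel {0..T}) \<psi>) 2"
    using emb \<psi> by (intro ennreal_pow_mono) (auto simp: embedding_constant_def)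
  also have "\<dots> = (ennreal b)\<^sup>2 * ennreal_pow (Lp_norm (1 / H) (restrict_space lborel {0..T}) \<psi>) 2"
    by (simp add: ennreal_pow_2 power_mult_distrib)
  also have "Lp_norm (1 / H) (restrict_space lborel {0..T}) \<psi> = ennreal_pow (\<integral>\<^sup>+r. ennreal_pow (\<phi> r) (1 / H) \<partial>lborel) H"
  proof -
    have "(\<integral>\<^sup>+r. ennreal (\<bar>\<psi> r\<bar> powr (1 / H)) \<partial>restrict_space lborel {0..T}) = (\<integral>\<^sup>+r. ennreal_pow (\<phi> r) (1 / H) \<partial>lborel)"
    proof (subst nn_integral_restrict_space, simp, intro nn_integral_cong_AE, use fin in eventually_elim)
      case (elim r)
      have "ennreal (\<bar>\<psi> r\<bar> powr (1 / H)) = ennreal_pow (\<phi> r) (1 / H)"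
        by (subst elim) (simp add: \<psi>_def ennreal_pow_ennreal)
      then show ?case using \<phi>0[of r] by (cases "r \<in> {0..T}") auto
    qed
    then show ?thesis by (simp add: Lp_norm_def)
  qed
  finally show ?thesis using H by (simp add: ennreal_pow_pow mult.commute)
qed

lemma Kstar_scale: "1 \<le> n \<Longrightarrow> 0 \<le> s \<Longrightarrow> Kstar c H n s t (\<lambda>x. a * h x) \<theta> = a * Kstar c H n s t h \<theta>"
  by (simp add: Kstar_eq_iter_int iter_int_scale)

end

section \<open>Norm bound, definedness and linear continuity for fixed s and t\<close>

locale fractional_embedding = fractional_kernel +
  fixes T b :: real and n :: nat and s t :: real
  assumes half_less_H: "1/2 < H" and b_pos: "0 < b" and emb: "embedding_constant c H T b"
    and n: "1 \<le> n" and s: "0 \<le> s" and s_less_t: "s < t" and t: "t \<le> T"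
begin

text \<open>A function on the simplex carries no information outside it; extension by 0 makes it
  measurable on the whole product space.\<close>

abbreviation trunc :: "((nat \<Rightarrow> real) \<Rightarrow> real) \<Rightarrow> (nat \<Rightarrow> real) \<Rightarrow> real" where
  "trunc h x \<equiv> h x * indicator (ord_simplex n t) x"

lemma iter_nn_embedding_bound:
  assumes "f \<in> borel_measurable (lborel_pow n)"
  shows "(\<integral>\<^sup>+\<theta>. (iter_nn n s t f \<theta>)\<^sup>2 \<partial>lborel_pow n)
    \<le> ((ennreal b)\<^sup>2) ^ n * ennreal_pow (\<integral>\<^sup>+x. ennreal_pow (f x) (1 / H) \<partial>lborel_pow n) (2 * H)"
  using half_less_H b_pos emb s t assms
  by (intro iter_nn_L2_bound[where T = T] embedding_ennreal) auto

lemma Kstar_trunc: "Kstar c H n s t h \<theta> = of_bool (\<theta> n \<noteq> s) * iter_int n s t (trunc h) \<theta>"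
  using Kstar_cong_simplex[of n t h "trunc h" s \<theta>] n s by (simp add: Kstar_eq_iter_int)

lemma nn_integral_simplex:
  fixes h :: "(nat \<Rightarrow> real) \<Rightarrow> real"
  shows "(\<integral>\<^sup>+x. ennreal_pow (ennreal \<bar>trunc h x\<bar>) (1 / H) \<partial>lborel_pow n)
    = (\<integral>\<^sup>+x. ennreal (\<bar>h x\<bar> powr (1 / H)) \<partial>lborel_on n (ord_simplex n t))"
  unfolding nn_integral_lborel_on[OF ord_simplex_in_sets[OF n]]
  by (intro nn_integral_cong) (auto simp: ennreal_pow_ennreal split: split_indicator)

text \<open>The iterated integral reads h only where s < \<theta> n < t, so the cut-off is made
  before the estimate. The factor \<open>of_bool\<close> can only decrease the absolute value, and
  the root of (b^2)^n is b^n.\<close>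

lemma Kstar_bound:
  assumes h: "h \<in> borel_measurable (lborel_on n (ord_simplex n t))"
  shows "Lp_norm 2 (lborel_on n (cube n t)) (Kstar c H n s t h)
    \<le> ennreal (b ^ n) * Lp_norm (1 / H) (lborel_on n (ord_simplex n t)) (\<lambda>\<theta>. h \<theta> * indicator {s<..<t} (\<theta> n))"
proof -
  define g where "g x = h x * indicator {s<..<t} (x n)" for x :: "nat \<Rightarrow> real"
  have "(\<lambda>x. x n) \<in> borel_measurable (lborel_pow n)"
    using measurable_component_singleton[of n "{1..n}" "\<lambda>_. lborel"] n by simp
  then have "(\<lambda>x. indicator {s<..<t} (x n) :: real) \<in> borel_measurable (lborel_pow n)"
    by (intro measurable_indicator_Ioo) auto
  then have "g \<in> borel_measurable (lborel_on n (ord_simplex n t))"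
    unfolding g_def by (intro borel_measurable_times h measurable_restrict_space1)
  then have g: "trunc g \<in> borel_measurable (lborel_pow n)"
    by (rule measurable_times_indicator_simplex[OF _ n order_refl])
  have le: "ennreal (\<bar>Kstar c H n s t h \<theta>\<bar> powr 2) \<le> (iter_nn n s t (\<lambda>x. ennreal \<bar>trunc g x\<bar>) \<theta>)\<^sup>2" for \<theta>
  proof -
    have "iter_int n s t h \<theta> = iter_int n s t (trunc g) \<theta>"
      by (intro iter_int_cong_simplex s n) (simp add: g_def)
    then have "\<bar>Kstar c H n s t h \<theta>\<bar> \<le> \<bar>iter_int n s t (trunc g) \<theta>\<bar>"
      using n s by (simp add: Kstar_eq_iter_int)
    then have "ennreal \<bar>Kstar c H n s t h \<theta>\<bar> \<le> iter_nn n s t (\<lambda>x. ennreal \<bar>trunc g x\<bar>) \<theta>"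
      using abs_iter_int_le[of n s t "trunc g" \<theta>] by (meson ennreal_leI order_trans)
    then have "(ennreal \<bar>Kstar c H n s t h \<theta>\<bar>)\<^sup>2 \<le> (iter_nn n s t (\<lambda>x. ennreal \<bar>trunc g x\<bar>) \<theta>)\<^sup>2"
      by (intro power_mono) auto
    then show ?thesis by (simp add: ennreal_power)
  qed
  have "(\<integral>\<^sup>+\<theta>. ennreal (\<bar>Kstar c H n s t h \<theta>\<bar> powr 2) \<partial>lborel_on n (cube n t))
    \<le> (\<integral>\<^sup>+\<theta>. (iter_nn n s t (\<lambda>x. ennreal \<bar>trunc g x\<bar>) \<theta>)\<^sup>2 \<partial>lborel_pow n)"
    unfolding nn_integral_lborel_on[OF cube_in_sets]
    by (intro nn_integral_mono) (use le in \<open>auto split: split_indicator\<close>)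
  also have "\<dots> \<le> ((ennreal b)\<^sup>2) ^ n * ennreal_pow (\<integral>\<^sup>+x. ennreal_pow (ennreal \<bar>trunc g x\<bar>) (1 / H) \<partial>lborel_pow n) (2 * H)"
    by (intro iter_nn_embedding_bound measurable_compose[OF _ measurable_ennreal] borel_measurable_abs g)
  also have "((ennreal b)\<^sup>2) ^ n = ennreal_pow (ennreal (b ^ n)) 2"
    using b_pos by (simp add: ennreal_pow_2 ennreal_power power_mult[symmetric] mult.commute)
  finally have "(\<integral>\<^sup>+\<theta>. ennreal (\<bar>Kstar c H n s t h \<theta>\<bar> powr 2) \<partial>lborel_on n (cube n t))
    \<le> ennreal_pow (ennreal (b ^ n)) 2 *
      ennreal_pow (\<integral>\<^sup>+x. ennreal (\<bar>g x\<bar> powr (1 / H)) \<partial>lborel_on n (ord_simplex n t)) (2 * H)"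
    unfolding nn_integral_simplex .
  from ennreal_pow_mono[OF _ this, of "1 / 2"]
  have "Lp_norm 2 (lborel_on n (cube n t)) (Kstar c H n s t h)
    \<le> ennreal_pow (ennreal_pow (ennreal (b ^ n)) 2 *
        ennreal_pow (\<integral>\<^sup>+x. ennreal (\<bar>g x\<bar> powr (1 / H)) \<partial>lborel_on n (ord_simplex n t)) (2 * H)) (1 / 2)"
    unfolding Lp_norm_def by (simp only: divide_nonneg_nonneg zero_le_one zero_le_numeral simp_thms)
  also have "\<dots> = ennreal (b ^ n) * Lp_norm (1 / H) (lborel_on n (ord_simplex n t)) g"
    by (simp add: Lp_norm_def ennreal_pow_mult ennreal_pow_pow)
  finally show ?thesis unfolding g_def .
qed

lemma Kstar_bound':
  assumes "h \<in> borel_measurable (lborel_on n (ord_simplex n t))"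
  shows "Lp_norm 2 (lborel_on n (cube n t)) (Kstar c H n s t h)
    \<le> ennreal (b ^ n) * Lp_norm (1 / H) (lborel_on n (ord_simplex n t)) h"
proof -
  have "Lp_norm (1 / H) (lborel_on n (ord_simplex n t)) (\<lambda>\<theta>. h \<theta> * indicator {s<..<t} (\<theta> n))
      \<le> Lp_norm (1 / H) (lborel_on n (ord_simplex n t)) h"
    unfolding Lp_norm_def using half_less_H
    by (intro ennreal_pow_mono nn_integral_mono) (auto split: split_indicator)
  with Kstar_bound[OF assms] show ?thesis
    by (meson mult_left_mono order_trans zero_le)
qed

text \<open>The square-integral estimate is applied to the absolute value of h, so the iterated
  integral is finite almost everywhere. Both definedness and additivity of \<open>Kstar\<close> rest
  on this.\<close>

lemma AE_iter_nn_Lp: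
  assumes h: "h \<in> Lp (1 / H) (lborel_on n (ord_simplex n t))"
  shows "AE \<theta> in lborel_on n (cube n t). \<theta> \<in> extensional {1..n} \<and> iter_nn n s t (\<lambda>x. ennreal \<bar>trunc h x\<bar>) \<theta> < \<infinity>"
proof -
  have tr: "trunc h \<in> borel_measurable (lborel_pow n)"
    using h by (intro measurable_times_indicator_simplex[OF _ n order_refl]) (simp add: Lp_def)
  then have tr': "(\<lambda>x. ennreal \<bar>trunc h x\<bar>) \<in> borel_measurable (lborel_pow n)"
    by (intro measurable_compose[OF _ measurable_ennreal] borel_measurable_abs)
  have "(\<integral>\<^sup>+x. ennreal (\<bar>h x\<bar> powr (1 / H)) \<partial>lborel_on n (ord_simplex n t)) < top"
    using h by (simp add: Lp_def Lp_norm_def)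
  then have "((ennreal b)\<^sup>2) ^ n * ennreal_pow (\<integral>\<^sup>+x. ennreal_pow (ennreal \<bar>trunc h x\<bar>) (1 / H) \<partial>lborel_pow n) (2 * H) < top"
    unfolding nn_integral_simplex
    by (auto simp: ennreal_mult_less_top power_less_top_ennreal)
  with iter_nn_embedding_bound[OF tr']
  have "(\<integral>\<^sup>+\<theta>. (iter_nn n s t (\<lambda>x. ennreal \<bar>trunc h x\<bar>) \<theta>)\<^sup>2 \<partial>lborel_pow n) < top"
    by (rule le_less_trans)
  then have "AE \<theta> in lborel_pow n. (iter_nn n s t (\<lambda>x. ennreal \<bar>trunc h x\<bar>) \<theta>)\<^sup>2 \<noteq> \<infinity>"
    using measurable_iter_nn[OF tr', of s t n] unfolding power2_eq_square
    by (intro nn_integral_PInf_AE borel_measurable_times_ennreal) auto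
  then have "AE \<theta> in lborel_pow n. \<theta> \<in> extensional {1..n} \<and> iter_nn n s t (\<lambda>x. ennreal \<bar>trunc h x\<bar>) \<theta> < \<infinity>"
    using AE_space
    by eventually_elim (auto simp: space_lborel_pow power2_eq_square ennreal_mult_eq_top_iff less_top)
  then show ?thesis
    by (subst AE_restrict_space_iff) (auto simp: cube_in_sets)
qed

lemma AE_Kstar_defined:
  assumes h: "h \<in> Lp (1 / H) (lborel_on n (ord_simplex n t))"
  shows "AE \<theta> in lborel_on n (cube n t). Kstar_defined c H n s t h \<theta>"
  using AE_iter_nn_Lp[OF h]
proof eventually_elim
  case (elim \<theta>)
  have "trunc h \<in> borel_measurable (lborel_pow n)"
    using h by (intro measurable_times_indicator_simplex[OF _ n order_refl]) (simp add: Lp_def)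
  then have "Kstar_defined c H n s t (trunc h) \<theta>"
    using elim by (intro Kstar_definedI[where N = n] s n) auto
  then show ?case
    using Kstar_defined_cong_simplex[of n t h "trunc h" s \<theta>] s n by simp
qed

lemma AE_Kstar_add:
  assumes f: "f \<in> Lp (1 / H) (lborel_on n (ord_simplex n t))"
    and g: "g \<in> Lp (1 / H) (lborel_on n (ord_simplex n t))"
  shows "AE \<theta> in lborel_on n (cube n t).
    Kstar c H n s t (\<lambda>x. f x + g x) \<theta> = Kstar c H n s t f \<theta> + Kstar c H n s t g \<theta>"
  using AE_iter_nn_Lp[OF f] AE_iter_nn_Lp[OF g]
proof eventually_elim
  case (elim \<theta>)
  have "trunc f \<in> borel_measurable (lborel_pow n)" "trunc g \<in> borel_measurable (lborel_pow n)"
    using f g by (auto intro!: measurable_times_indicator_simplex[OF _ n order_refl] simp: Lp_def)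
  from iter_int_add[OF this, of \<theta> n s t] elim
  have "iter_int n s t (\<lambda>x. trunc f x + trunc g x) \<theta> = iter_int n s t (trunc f) \<theta> + iter_int n s t (trunc g) \<theta>"
    by blast
  then show ?case
    by (simp add: Kstar_trunc distrib_left distrib_right)
qed

lemma measurable_Kstar:
  assumes "h \<in> borel_measurable (lborel_on n (ord_simplex n t))"
  shows "Kstar c H n s t h \<in> borel_measurable (lborel_on n (cube n t))"
proof -
  have "iter_int n s t (trunc h) \<in> borel_measurable (lborel_pow n)"
    by (intro measurable_iter_int measurable_times_indicator_simplex[OF assms n order_refl])
  moreover have "(\<lambda>x. x n) \<in> borel_measurable (lborel_pow n)"
    using measurable_component_singleton[of n "{1..n}" "\<lambda>_. lborel"] n by simp
  then have "(\<lambda>x. of_bool (x n \<noteq> s) :: real) \<in> borel_measurable (lborel_pow n)"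
    unfolding of_bool_def by measurable
  ultimately show ?thesis
    unfolding Kstar_trunc[abs_def] by (intro measurable_restrict_space1 borel_measurable_times)
qed

lemma AE_Kstar_diff:
  assumes f: "f \<in> Lp (1 / H) (lborel_on n (ord_simplex n t))"
    and g: "g \<in> Lp (1 / H) (lborel_on n (ord_simplex n t))"
  shows "AE \<theta> in lborel_on n (cube n t).
    Kstar c H n s t (\<lambda>x. g x - f x) \<theta> = Kstar c H n s t g \<theta> - Kstar c H n s t f \<theta>"
proof -
  have "(\<lambda>x. - 1 * f x) \<in> Lp (1 / H) (lborel_on n (ord_simplex n t))"
    using f by (auto simp: Lp_def Lp_norm_def)
  from AE_Kstar_add[OF g this] show ?thesis
    unfolding Kstar_scale[OF n s] by simp
qed

text \<open>By additivity the difference of two images is almost everywhere the image of the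
  difference. Respect for almost everywhere equality and continuity then both follow from the norm
  bound \<open>norm_diff\<close>.\<close>

lemma Kstar_Lp_linear_continuous:
  "Lp_linear_continuous (1 / H) (lborel_on n (ord_simplex n t)) 2 (lborel_on n (cube n t)) (Kstar c H n s t)"
proof -
  let ?M = "lborel_on n (ord_simplex n t)" and ?N = "lborel_on n (cube n t)" and ?A = "Kstar c H n s t"
  have meas: "f \<in> borel_measurable ?M" if "f \<in> Lp (1 / H) ?M" for f
    using that by (simp add: Lp_def)
  have norm_diff: "Lp_norm 2 ?N (\<lambda>y. ?A g y - ?A f y) \<le> ennreal (b ^ n) * Lp_norm (1 / H) ?M (\<lambda>x. g x - f x)"
    if f: "f \<in> Lp (1 / H) ?M" and g: "g \<in> Lp (1 / H) ?M" for f g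
  proof -
    have "Lp_norm 2 ?N (\<lambda>y. ?A g y - ?A f y) = Lp_norm 2 ?N (?A (\<lambda>x. g x - f x))"
      unfolding Lp_norm_def
      by (intro arg_cong2[where f = ennreal_pow] nn_integral_cong_AE refl, use AE_Kstar_diff[OF f g] in eventually_elim) simp
    also have "\<dots> \<le> ennreal (b ^ n) * Lp_norm (1 / H) ?M (\<lambda>x. g x - f x)"
      by (intro Kstar_bound' borel_measurable_diff meas f g)
    finally show ?thesis .
  qed
  show ?thesis
    unfolding Lp_linear_continuous_def
  proof (intro conjI ballI allI impI)
    fix f assume f: "f \<in> Lp (1 / H) ?M"
    have "Lp_norm 2 ?N (?A f) < \<infinity>"
      using f by (intro le_less_trans[OF Kstar_bound'[OF meas[OF f]]]) (auto simp: Lp_def ennreal_mult_less_top)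
    then show "?A f \<in> Lp 2 ?N"
      using measurable_Kstar[OF meas[OF f]] by (simp add: Lp_def)
    show "AE y in ?N. ?A (\<lambda>x. a * f x) y = a * ?A f y" for a
      by (simp add: Kstar_scale[OF n s])
    fix g assume g: "g \<in> Lp (1 / H) ?M"
    show "AE y in ?N. ?A (\<lambda>x. f x + g x) y = ?A f y + ?A g y"
      by (rule AE_Kstar_add[OF f g])
    assume "AE x in ?M. f x = g x"
    then have "(\<integral>\<^sup>+x. ennreal (\<bar>f x - g x\<bar> powr (1 / H)) \<partial>?M) = (\<integral>\<^sup>+x. 0 \<partial>?M)"
      by (intro nn_integral_cong_AE) (auto elim!: eventually_mono)
    then have "Lp_norm 2 ?N (\<lambda>y. ?A f y - ?A g y) = 0"
      using norm_diff[OF g f] by (simp add: Lp_norm_def)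
    then have "(\<integral>\<^sup>+y. ennreal (\<bar>?A f y - ?A g y\<bar> powr 2) \<partial>?N) = 0"
      by (simp add: Lp_norm_def)
    then have "AE y in ?N. ennreal (\<bar>?A f y - ?A g y\<bar> powr 2) = 0"
      using measurable_Kstar[OF meas[OF f]] measurable_Kstar[OF meas[OF g]]
      by (subst (asm) nn_integral_0_iff_AE) auto
    then show "AE y in ?N. ?A f y = ?A g y"
      by eventually_elim (simp add: ennreal_eq_0_iff)
  next
    fix f and \<epsilon> :: real assume f: "f \<in> Lp (1 / H) ?M" and \<epsilon>: "0 < \<epsilon>"
    show "\<exists>\<delta>>0. \<forall>g\<in>Lp (1 / H) ?M. Lp_norm (1 / H) ?M (\<lambda>x. g x - f x) < ennreal \<delta> \<longrightarrow>
        Lp_norm 2 ?N (\<lambda>y. ?A g y - ?A f y) < ennreal \<epsilon>"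
    \<comment> \<open>The operator is Lipschitz with constant b^n, which dictates this
      \<delta>.\<close>
    proof (intro exI[of _ "\<epsilon> / b ^ n"] conjI ballI impI)
      show "0 < \<epsilon> / b ^ n" using \<epsilon> b_pos by simp
      fix g assume g: "g \<in> Lp (1 / H) ?M" and less: "Lp_norm (1 / H) ?M (\<lambda>x. g x - f x) < ennreal (\<epsilon> / b ^ n)"
      have "ennreal (b ^ n) * Lp_norm (1 / H) ?M (\<lambda>x. g x - f x) < ennreal (b ^ n) * ennreal (\<epsilon> / b ^ n)"
        using less b_pos by (intro ennreal_mult_strict_left_mono) auto
      also have "\<dots> = ennreal \<epsilon>"
        using b_pos \<epsilon> by (simp flip: ennreal_mult)
      finally show "Lp_norm 2 ?N (\<lambda>y. ?A g y - ?A f y) < ennreal \<epsilon>"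
        using norm_diff[OF f g] by (rule le_less_trans[rotated])
    qed
  qed
qed

section \<open>Passing from exponent q to exponent 1/H on a slab of the simplex\<close>

text \<open>The ordering is forgotten: the slab lies in a box with n - 1 sides [0,t] and last side
  ]s,t[.\<close>

lemma emeasure_simplex_slab:
  "emeasure (lborel_pow n) {x \<in> ord_simplex n t. s < x n \<and> x n < t} \<le> ennreal (t ^ (n - 1) * (t - s))"
proof -
  interpret product_sigma_finite "\<lambda>_::nat. lborel :: real measure" ..
  define A where "A i = (if i = n then {s<..<t} else {0..t})" for i
  have "{x \<in> ord_simplex n t. s < x n \<and> x n < t} \<subseteq> Pi\<^sub>E {1..n} A"
  proof
    fix x assume "x \<in> {x \<in> ord_simplex n t. s < x n \<and> x n < t}"
    then have x: "x \<in> ord_simplex n t" "s < x n" "x n < t" by auto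
    show "x \<in> Pi\<^sub>E {1..n} A"
    proof (rule PiE_I)
      show "x i \<in> A i" if "i \<in> {1..n}" for i
        using ord_simplex_bounds[OF x(1) that] x(2,3) by (simp add: A_def)
      show "x i = undefined" if "i \<notin> {1..n}" for i
        using x(1) that unfolding ord_simplex_def by (blast intro: extensional_arb)
    qed
  qed
  then have "emeasure (lborel_pow n) {x \<in> ord_simplex n t. s < x n \<and> x n < t} \<le> emeasure (lborel_pow n) (Pi\<^sub>E {1..n} A)"
    by (intro emeasure_mono sets_PiM_I_finite) (auto simp: A_def)
  also have "\<dots> = (\<Prod>i\<in>{1..n}. emeasure lborel (A i))"
    by (intro emeasure_PiM) (auto simp: A_def)
  also have "\<dots> = (\<Prod>i\<in>insert n {1..<n}. emeasure lborel (A i))"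
    by (rule prod.cong) (use n in auto)
  also have "(\<Prod>i\<in>insert n {1..<n}. emeasure lborel (A i)) = ennreal (t - s) * (\<Prod>i\<in>{1..<n}. ennreal t)"
    using s s_less_t by (subst prod.insert) (auto simp: A_def intro!: arg_cong2[where f = "(*)"] prod.cong)
  also have "\<dots> = ennreal (t ^ (n - 1) * (t - s))"
    using s s_less_t by (simp add: ennreal_power ennreal_mult mult.commute)
  finally show ?thesis .
qed

text \<open>Jensen's inequality with exponent qH > 1, applied to the (1/H)-th power of the absolute
  value of h, yields the measure of the slab to the power H - 1/q. The last side gives the power of
  t - s; the other n - 1 sides give the power of \<open>max 1 t\<close>, which is 1 for n = 1 or t
  <= 1.\<close>

lemma Lp_norm_slab_le:
  assumes h: "h \<in> borel_measurable (lborel_on n (ord_simplex n t))" and q: "1 < q * H"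
  shows "Lp_norm (1 / H) (lborel_on n (ord_simplex n t)) (\<lambda>\<theta>. h \<theta> * indicator {s<..<t} (\<theta> n))
    \<le> ennreal (max 1 t powr ((real n - 1) * (H - 1 / q))) *
      Lp_norm q (lborel_on n (ord_simplex n t)) h * ennreal (\<bar>t - s\<bar> powr (H - 1 / q))"
proof -
  let ?S = "{x \<in> ord_simplex n t. s < x n \<and> x n < t}"
  have H0: "0 < H" using half_less_H by simp
  have q0: "0 < q" using q H0 zero_less_mult_pos2[of q H] by simp
  have Hq: "0 < H - 1 / q" using q q0 by (simp add: field_simps)
  have cn: "(\<lambda>x. x n) \<in> borel_measurable (lborel_pow n)"
    using measurable_component_singleton[of n "{1..n}" "\<lambda>_. lborel"] n by simp
  have S: "?S \<in> sets (lborel_pow n)"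
  proof -
    have "ord_simplex n t \<inter> {x \<in> space (lborel_pow n). s < x n \<and> x n < t} \<in> sets (lborel_pow n)"
      by (intro sets.Int ord_simplex_in_sets n sets.sets_Collect_conj borel_measurable_less cn borel_measurable_const)
    also have "ord_simplex n t \<inter> {x \<in> space (lborel_pow n). s < x n \<and> x n < t} = ?S"
      by (auto simp: space_lborel_pow ord_simplex_def)
    finally show ?thesis .
  qed
  have space_S: "space (lborel_on n ?S) = ?S"
    by (auto simp: space_restrict_space space_lborel_pow ord_simplex_def)
  have emeasure_S: "emeasure (lborel_on n ?S) ?S = emeasure (lborel_pow n) ?S"
    using S by (intro emeasure_restrict_space sets.Int sets.top) auto
  interpret S: finite_measure "lborel_on n ?S"
  proof
    have "emeasure (lborel_pow n) ?S < top"
      by (rule le_less_trans[OF emeasure_simplex_slab]) simp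
    then show "emeasure (lborel_on n ?S) (space (lborel_on n ?S)) \<noteq> \<infinity>"
      unfolding space_S emeasure_S by simp
  qed
  have "Lp_norm (1 / H) (lborel_on n (ord_simplex n t)) (\<lambda>\<theta>. h \<theta> * indicator {s<..<t} (\<theta> n))
      = ennreal_pow (\<integral>\<^sup>+x. ennreal (\<bar>h x\<bar> powr (1 / H)) \<partial>lborel_on n ?S) H"
    unfolding Lp_norm_def nn_integral_lborel_on[OF S] nn_integral_lborel_on[OF ord_simplex_in_sets[OF n]]
    by (intro arg_cong2[where f = ennreal_pow] nn_integral_cong) (auto split: split_indicator)
  \<comment> \<open>Writing H as qH * (1/q) exposes the power to which Jensen applies. The mass then
    has exponent (qH - 1)/q = H - 1/q.\<close>
  also have "\<dots> = ennreal_pow (ennreal_pow (\<integral>\<^sup>+x. ennreal (\<bar>h x\<bar> powr (1 / H)) \<partial>lborel_on n ?S) (q * H)) (1 / q)"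
    using q0 by (simp add: ennreal_pow_pow)
  also have "\<dots> \<le> ennreal_pow (ennreal_pow (emeasure (lborel_pow n) ?S) (q * H - 1) *
      (\<integral>\<^sup>+x. ennreal (\<bar>h x\<bar> powr q) \<partial>lborel_on n ?S)) (1 / q)"
  proof (intro ennreal_pow_mono)
    have "h \<in> borel_measurable (lborel_on n ?S)"
      using measurable_restrict_mono[OF h, of ?S] by auto
    then have "(\<lambda>x. ennreal (\<bar>h x\<bar> powr (1 / H))) \<in> borel_measurable (lborel_on n ?S)"
      by measurable
    from S.ennreal_pow_Jensen[OF q this]
    show "ennreal_pow (\<integral>\<^sup>+x. ennreal (\<bar>h x\<bar> powr (1 / H)) \<partial>lborel_on n ?S) (q * H)
      \<le> ennreal_pow (emeasure (lborel_pow n) ?S) (q * H - 1) * (\<integral>\<^sup>+x. ennreal (\<bar>h x\<bar> powr q) \<partial>lborel_on n ?S)"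
      unfolding space_S emeasure_S using H0 by (simp add: ennreal_pow_ennreal powr_powr)
  qed (use q0 in auto)
  also have "\<dots> = ennreal_pow (emeasure (lborel_pow n) ?S) (H - 1 / q) *
      ennreal_pow (\<integral>\<^sup>+x. ennreal (\<bar>h x\<bar> powr q) \<partial>lborel_on n ?S) (1 / q)"
    using q0 by (simp add: ennreal_pow_mult ennreal_pow_pow field_simps)
  also have "\<dots> \<le> ennreal (max 1 t powr ((real n - 1) * (H - 1 / q)) * \<bar>t - s\<bar> powr (H - 1 / q)) *
      Lp_norm q (lborel_on n (ord_simplex n t)) h"
  proof (intro mult_mono)
    have "ennreal_pow (emeasure (lborel_pow n) ?S) (H - 1 / q) \<le> ennreal_pow (ennreal (t ^ (n - 1) * (t - s))) (H - 1 / q)"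
      using Hq by (intro ennreal_pow_mono emeasure_simplex_slab) auto
    also have "\<dots> \<le> ennreal_pow (ennreal (max 1 t ^ (n - 1) * (t - s))) (H - 1 / q)"
      using Hq s s_less_t by (intro ennreal_pow_mono ennreal_leI mult_right_mono power_mono) auto
    also have "\<dots> = ennreal (max 1 t powr ((real n - 1) * (H - 1 / q)) * \<bar>t - s\<bar> powr (H - 1 / q))"
      using s s_less_t n
      by (simp add: ennreal_pow_ennreal powr_mult powr_realpow[symmetric] powr_powr of_nat_diff)
    finally show "ennreal_pow (emeasure (lborel_pow n) ?S) (H - 1 / q)
      \<le> ennreal (max 1 t powr ((real n - 1) * (H - 1 / q)) * \<bar>t - s\<bar> powr (H - 1 / q))" .
    show "ennreal_pow (\<integral>\<^sup>+x. ennreal (\<bar>h x\<bar> powr q) \<partial>lborel_on n ?S) (1 / q) \<le> Lp_norm q (lborel_on n (ord_simplex n t)) h"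
      unfolding Lp_norm_def nn_integral_lborel_on[OF S] nn_integral_lborel_on[OF ord_simplex_in_sets[OF n]]
      using q0 by (intro ennreal_pow_mono nn_integral_mono) (auto split: split_indicator)
  qed auto
  finally show ?thesis
    by (simp add: ennreal_mult mult_ac)
qed

end

lemma Lp_lborel_on_simplex_mono:
  assumes h: "h \<in> Lp p (lborel_on n (ord_simplex n T))" and "t \<le> T" "1 \<le> n" "0 < p"
  shows "h \<in> Lp p (lborel_on n (ord_simplex n t))"
proof -
  note sub = ord_simplex_mono[OF \<open>t \<le> T\<close>, of n]
  have "h \<in> borel_measurable (lborel_on n (ord_simplex n t))"
    using h by (intro measurable_restrict_mono[OF _ sub]) (simp add: Lp_def)
  moreover have "Lp_norm p (lborel_on n (ord_simplex n t)) h \<le> Lp_norm p (lborel_on n (ord_simplex n T)) h"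
    unfolding Lp_norm_def nn_integral_lborel_on[OF ord_simplex_in_sets[OF \<open>1 \<le> n\<close>]]
    using \<open>0 < p\<close> sub
    by (intro ennreal_pow_mono nn_integral_mono mult_left_mono) (auto simp: indicator_def)
  moreover have "Lp_norm p (lborel_on n (ord_simplex n T)) h < \<infinity>"
    using h by (simp add: Lp_def)
  ultimately show ?thesis
    unfolding Lp_def by (blast intro: le_less_trans)
qed

theorem proposition3p1:
  fixes P :: "'w measure" and W :: "real \<Rightarrow> 'w \<Rightarrow> real"
    and T H c b :: real and n :: nat
  assumes "T > 0" and "1/2 < H" and "H < 1" and "n \<ge> 1"
    and "brownian_motion P W" and "kernel_constant P W H c"
    and "b > 0" and "embedding_constant c H T b"
  shows
    "(\<forall>h \<in> Lp (1/H) (lborel_on n (ord_simplex n T)). \<forall>s t. 0 \<le> s \<and> s < t \<and> t \<le> T \<longrightarrow>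
        (AE \<theta> in lborel_on n (cube n t). Kstar_defined c H n s t h \<theta>) \<and>
        Lp_norm 2 (lborel_on n (cube n t)) (Kstar c H n s t h)
          \<le> ennreal (2 powr (real n / 2) * b ^ n) *
             Lp_norm (1/H) (lborel_on n (ord_simplex n t))
               (\<lambda>\<theta>. h \<theta> * indicator {s<..<t} (\<theta> n))) \<and>
     (\<forall>s t. 0 \<le> s \<and> s < t \<and> t \<le> T \<longrightarrow>
        Lp_linear_continuous (1/H) (lborel_on n (ord_simplex n t))
          2 (lborel_on n (cube n t)) (Kstar c H n s t)) \<and>
     (\<forall>q. q * H > 1 \<longrightarrow>
        (\<forall>h \<in> Lp q (lborel_on n (ord_simplex n T)). \<forall>s t. 0 \<le> s \<and> s < t \<and> t \<le> T \<longrightarrow>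
           Lp_norm 2 (lborel_on n (cube n t)) (Kstar c H n s t h)
             \<le> ennreal (2 powr (real n / 2) * b ^ n * max 1 t powr ((real n - 1) * (H - 1/q))) *
                Lp_norm q (lborel_on n (ord_simplex n t)) h *
                ennreal (\<bar>t - s\<bar> powr (H - 1/q))))"
proof -
  have c: "0 < c"
    using assms(6) by (simp add: kernel_constant_def)
  interpret K: fractional_kernel "frac_kernel c H" c H
    by (rule fractional_kernel_frac_kernel[OF c assms(2)])
  have loc: "fractional_embedding (frac_kernel c H) c H T b n s t" if "0 \<le> s" "s < t" "t \<le> T" for s t
    by unfold_locales (use assms that in auto)
  \<comment> \<open>The estimates above have the constant b^n; this factor passes from it to the
    stated constant.\<close>
  have two: "1 \<le> 2 powr (real n / 2)"
    by (rule ge_one_powr_ge_zero) auto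
  have p0: "0 < 1 / H"
    using assms(2) by simp
  have a: "(AE \<theta> in lborel_on n (cube n t). Kstar_defined c H n s t h \<theta>) \<and>
        Lp_norm 2 (lborel_on n (cube n t)) (Kstar c H n s t h)
          \<le> ennreal (2 powr (real n / 2) * b ^ n) *
             Lp_norm (1/H) (lborel_on n (ord_simplex n t)) (\<lambda>\<theta>. h \<theta> * indicator {s<..<t} (\<theta> n))"
    if h: "h \<in> Lp (1/H) (lborel_on n (ord_simplex n T))" and st: "0 \<le> s" "s < t" "t \<le> T" for h s t
  proof
    interpret fractional_embedding "frac_kernel c H" c H T b n s t by (rule loc[OF st])
    have ht: "h \<in> Lp (1/H) (lborel_on n (ord_simplex n t))"
      by (rule Lp_lborel_on_simplex_mono[OF h st(3) assms(4) p0])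
    show "AE \<theta> in lborel_on n (cube n t). Kstar_defined c H n s t h \<theta>"
      by (rule AE_Kstar_defined[OF ht])
    have "ennreal (b ^ n) \<le> ennreal (2 powr (real n / 2) * b ^ n)"
      using two assms(7) by (intro ennreal_leI) simp
    then show "Lp_norm 2 (lborel_on n (cube n t)) (Kstar c H n s t h)
          \<le> ennreal (2 powr (real n / 2) * b ^ n) *
             Lp_norm (1/H) (lborel_on n (ord_simplex n t)) (\<lambda>\<theta>. h \<theta> * indicator {s<..<t} (\<theta> n))"
      using ht by (intro order_trans[OF Kstar_bound] mult_right_mono) (auto simp: Lp_def)
  qed
  have lin: "Lp_linear_continuous (1/H) (lborel_on n (ord_simplex n t)) 2 (lborel_on n (cube n t)) (Kstar c H n s t)"
    if st: "0 \<le> s" "s < t" "t \<le> T" for s t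
    by (rule fractional_embedding.Kstar_Lp_linear_continuous[OF loc[OF st]])
  have bq: "Lp_norm 2 (lborel_on n (cube n t)) (Kstar c H n s t h)
             \<le> ennreal (2 powr (real n / 2) * b ^ n * max 1 t powr ((real n - 1) * (H - 1/q))) *
                Lp_norm q (lborel_on n (ord_simplex n t)) h * ennreal (\<bar>t - s\<bar> powr (H - 1/q))"
    if q: "1 < q * H" and h: "h \<in> Lp q (lborel_on n (ord_simplex n T))" and st: "0 \<le> s" "s < t" "t \<le> T" for q h s t
  proof -
    interpret fractional_embedding "frac_kernel c H" c H T b n s t by (rule loc[OF st])
    have "0 < q"
      using q assms(2) zero_less_mult_pos2[of q H] by simp
    from Lp_lborel_on_simplex_mono[OF h st(3) assms(4) this]
    have ht: "h \<in> borel_measurable (lborel_on n (ord_simplex n t))"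
      by (simp add: Lp_def)
    let ?B = "ennreal (max 1 t powr ((real n - 1) * (H - 1/q))) *
      Lp_norm q (lborel_on n (ord_simplex n t)) h * ennreal (\<bar>t - s\<bar> powr (H - 1/q))"
    have "Lp_norm 2 (lborel_on n (cube n t)) (Kstar c H n s t h) \<le> ennreal (b ^ n) * ?B"
      by (rule order_trans[OF Kstar_bound[OF ht] mult_left_mono[OF Lp_norm_slab_le[OF ht q]]]) simp
    also have "\<dots> \<le> ennreal (2 powr (real n / 2) * b ^ n) * ?B"
      using two assms(7) by (intro mult_right_mono ennreal_leI) auto
    also have "\<dots> = ennreal (2 powr (real n / 2) * b ^ n * max 1 t powr ((real n - 1) * (H - 1/q))) *
                Lp_norm q (lborel_on n (ord_simplex n t)) h * ennreal (\<bar>t - s\<bar> powr (H - 1/q))"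
      using assms(7) by (simp add: ennreal_mult mult.assoc)
    finally show ?thesis .
  qed
  show ?thesis
    using a lin bq by blast
qed

end
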